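(* Let $h_0>0$ satisfy $$\frac{(T_0-T_{0l})k_l}{(T_{0l}-T_\infty)\sqrt{\pi \alpha_l}}<h_0<\frac{(T_0-T_{0s})k_l}{(T_{0s}-T_\infty)\sqrt{\pi \alpha_l}},$$ and let $\widehat s(t)=2\delta\sqrt{\alpha_s t}$, $\widehat T_k$, $\widehat T_s,\widehat T_l,\widehat C_s,\widehat C_l$ be the similarity solution of problem $(P_2)$ given in the context. Put $$\widehat T_1=\widehat T_s(0,t)=\widehat T_k-\frac{h_0\sqrt{\pi\alpha_s}\,\mathrm{erf}(\delta)(\widehat T_k-T_\infty)}{k_s+h_0\sqrt{\pi\alpha_s}\,\mathrm{erf}(\delta)}.$$ If in the Rubinstein solution $\widetilde s(t)=2\mu\sqrt{\alpha_s t}$, $\widetilde T_k$, $\widetilde T_s,\widetilde T_l,\widetilde C_s,\widetilde C_l$ of problem $(P_R)$ (see the context) one takes $T_1=\widehat T_1$, then the two free boundary problems $(P_2)$ and $(P_R)$ are equivalent, that is, $$\mu=\delta,\quad \widehat T_k=\widetilde T_k,$$ $$\widehat T_s(x,t)=\widetilde T_s(x,t),\quad \widehat T_l(x,t)=\widetilde T_l(x,t),\quad \widehat C_s(x,t)=\widetilde C_s(x,t),\quad \widehat C_l(x,t)=\widetilde C_l(x,t).$$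
   Context: Data. $\alpha_s,\alpha_l,d_s,d_l,k_s,k_l,\rho,\gamma$ are positive constants (subscripts $s$, $l$: solid, liquid). $T_A<T_B$ are real numbers, and $f_l,f_s:[T_A,T_B]\to\mathbb R$ are continuous strictly increasing functions with $$f_l(T_A)=f_s(T_A)<f_l(T)<f_s(T)<f_l(T_B)=f_s(T_B),\quad T_A<T<T_B.$$ $C_0$ is a constant with $f_l(T_A)<C_0<f_l(T_B)$, and $T_{0l}=f_l^{-1}(C_0)$, $T_{0s}=f_s^{-1}(C_0)$. $T_0$ is a constant with $T_A<T_0<T_B$. The alloy is initially liquid, i.e. $C_0<f_l(T_0)$. $T_\infty$ is a real constant (the bulk temperature), such that the two bounds on $h_0$ are defined. Problem $(P_2)$. Find $s(t)>0$ ($t>0$), a constant $T_k\in(T_A,T_B)$, functions $T_s,C_s$ on $0<x<s(t)$, $t>0$, and $T_l,C_l$ on $x>s(t)$, $t>0$, such that, for all $t>0$: (i) $\alpha_s T_{s,xx}=T_{s,t}$ for $0<x<s(t)$; (ii) $\alpha_l T_{l,xx}=T_{l,t}$ for $x>s(t)$; (iii) $d_s C_{s,xx}=C_{s,t}$ for $0<x<s(t)$; (iv) $d_l C_{l,xx}=C_{l,t}$ for $x>s(t)$; (v) $k_s T_{s,x}(0,t)=\frac{h_0}{\sqrt t}(T_s(0,t)-T_\infty)$; (vi) $T_s(s(t),t)=T_l(s(t),t)=T_k$; (vii) $T_l(x,0)=T_0$ for $x>0$; (viii) $T_l(\infty,t)=T_0$; (ix) $C_{s,x}(0,t)=0$;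 (x) $C_s(s(t),t)=f_s(T_k)$; (xi) $C_l(x,0)=C_0$ for $x>0$; (xii) $C_l(s(t),t)=f_l(T_k)$; (xiii) $k_sT_{s,x}(s(t),t)-k_lT_{l,x}(s(t),t)=\gamma\rho s'(t)$; (xiv) $d_lC_{l,x}(s(t),t)-d_sC_{s,x}(s(t),t)=[f_s(T_k)-f_l(T_k)]s'(t)$. Problem $(P_R)$ is obtained from $(P_2)$ by replacing (v) by the condition that the solid temperature at $x=0$ equals a constant $T_1$ for all $t>0$. Functions. $\mathrm{erf}(x)=\frac{2}{\sqrt\pi}\int_0^x e^{-t^2}dt$, $\mathrm{erfc}=1-\mathrm{erf}$; write $c=\sqrt{\alpha_s/\alpha_l}$. For $x>0$: $$Q(x)=\sqrt{\pi}\,x e^{x^2}\mathrm{erfc}(x),\quad Q_1(x)=\sqrt\pi\,xe^{x^2}\mathrm{erf}(x),\quad F_1(x)=e^{x^2}\mathrm{erfc}(x),\quad M(x)=\Big[Q\big(\sqrt{\alpha_s/d_l}\,x\big)\Big]^{-1},$$ $$F_2(x)=\frac{h_0k_s\sqrt{\pi\alpha_l}\,e^{-x^2}F_1(cx)}{k_l(k_s+h_0\sqrt{\pi\alpha_s}\,\mathrm{erf}(x))},\quad H(x)=\frac{h_0k_s\sqrt{\pi\alpha_l}}{xe^{x^2}(k_s+h_0\sqrt{\pi\alpha_s}\,\mathrm{erf}(x))}+\frac{k_l\sqrt{\pi\alpha_s}}{\sqrt{\alpha_l}\,Q(cx)},$$ $$W(x)=T_\infty+\frac{T_0-T_\infty}{F_2(x)+1}+\frac{\gamma\rho\sqrt{\pi\alpha_s\alpha_l}}{H(x)},$$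 $$G(x)=\frac{\gamma\rho\alpha_s\alpha_lQ_1(x)Q(cx)+T_1k_s\alpha_lQ(cx)+T_0k_l\alpha_sQ_1(x)}{k_s\alpha_lQ(cx)+k_l\alpha_sQ_1(x)},$$ and $\phi(x)=\frac{f_s(x)-f_l(x)}{C_0-f_l(x)}$ for $x\in(T_A,T_{0l})\cup(T_{0l},T_B)$. Similarity solution of $(P_2)$ (under the stated bounds on $h_0$): $\widehat s(t)=2\delta\sqrt{\alpha_st}$, $$\widehat T_s=\widehat T_k+\frac{h_0\sqrt{\pi\alpha_s}(\widehat T_k-T_\infty)}{k_s+h_0\sqrt{\pi\alpha_s}\,\mathrm{erf}(\delta)}\Big(\mathrm{erf}\Big(\frac{x}{2\sqrt{\alpha_st}}\Big)-\mathrm{erf}(\delta)\Big),\quad \widehat T_l=T_0+\frac{\widehat T_k-T_0}{\mathrm{erfc}(c\delta)}\mathrm{erfc}\Big(\frac{x}{2\sqrt{\alpha_lt}}\Big),$$ $$\widehat C_s=f_s(\widehat T_k),\quad \widehat C_l=C_0+\frac{f_l(\widehat T_k)-C_0}{\mathrm{erfc}(\sqrt{\alpha_s/d_l}\,\delta)}\mathrm{erfc}\Big(\frac{x}{2\sqrt{d_lt}}\Big),$$ where $(\delta,\widehat T_k)$ is the unique pair with $\widehat T_k=W(\delta)$, $M(\delta)=\phi(\widehat T_k)$, $\delta>0$, $T_A<\widehat T_k<T_B$. Rubinstein solution of $(P_R)$: $\widetilde s(t)=2\mu\sqrt{\alpha_st}$, $$\widetilde T_s=T_1+\frac{\widetilde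 T_k-T_1}{\mathrm{erf}(\mu)}\mathrm{erf}\Big(\frac{x}{2\sqrt{\alpha_st}}\Big),\quad \widetilde T_l=T_0+\frac{\widetilde T_k-T_0}{\mathrm{erfc}(c\mu)}\mathrm{erfc}\Big(\frac{x}{2\sqrt{\alpha_lt}}\Big),$$ $$\widetilde C_s=f_s(\widetilde T_k),\quad \widetilde C_l=C_0+\frac{f_l(\widetilde T_k)-C_0}{\mathrm{erfc}(\sqrt{\alpha_s/d_l}\,\mu)}\mathrm{erfc}\Big(\frac{x}{2\sqrt{d_lt}}\Big),$$ where $(\mu,\widetilde T_k)$ is the (unique) pair with $\widetilde T_k=G(\mu)$, $M(\mu)=\phi(\widetilde T_k)$, $\mu>0$, $T_A<\widetilde T_k<T_B$. Solid functions are defined on $0<x<\widehat s(t)$ (resp. $\widetilde s(t)$), liquid functions on $x>\widehat s(t)$ (resp. $\widetilde s(t)$), $t>0$. *)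

theory Defs
  imports "HOL-Analysis.Analysis"
begin

definition erf :: "real \<Rightarrow> real" where
  "erf x = 2 / sqrt pi * (LBINT t=0..x. exp (- t\<^sup>2))"

definition erfc :: "real \<Rightarrow> real" where
  "erfc x = 1 - erf x"

text \<open>Subscripts: s = solid, l = liquid. The field T_bulk is the bulk temperature
  (T with subscript infinity). Only the values of the liquidus and solidus
  functions between the two melting temperatures matter. The heat transfer coefficient and the
  prescribed face temperature are not part of the record, since each belongs to only one of the
  two problems.\<close>

record alloy =
  \<alpha>\<^sub>s :: real
  \<alpha>\<^sub>l :: real
  d\<^sub>s :: real
  d\<^sub>l :: real
  k\<^sub>s :: real
  k\<^sub>l :: real
  \<rho> :: real
  \<gamma> :: real
  T\<^sub>A :: real
  T\<^sub>B :: real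
  f\<^sub>l :: "real \<Rightarrow> real"
  f\<^sub>s :: "real \<Rightarrow> real"
  C\<^sub>0 :: real
  T\<^sub>0 :: real
  T_bulk :: real

definition alloy_data :: "alloy \<Rightarrow> bool" where
  "alloy_data D \<longleftrightarrow>
     0 < \<alpha>\<^sub>s D \<and> 0 < \<alpha>\<^sub>l D \<and> 0 < d\<^sub>s D \<and> 0 < d\<^sub>l D \<and> 0 < k\<^sub>s D \<and> 0 < k\<^sub>l D \<and> 0 < \<rho> D \<and> 0 < \<gamma> D \<and>
     T\<^sub>A D < T\<^sub>B D \<and>
     continuous_on {T\<^sub>A D..T\<^sub>B D} (f\<^sub>l D) \<and> continuous_on {T\<^sub>A D..T\<^sub>B D} (f\<^sub>s D) \<and>
     strict_mono_on {T\<^sub>A D..T\<^sub>B D} (f\<^sub>l D) \<and> strict_mono_on {T\<^sub>A D..T\<^sub>B D} (f\<^sub>s D) \<and>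
     f\<^sub>l D (T\<^sub>A D) = f\<^sub>s D (T\<^sub>A D) \<and> f\<^sub>l D (T\<^sub>B D) = f\<^sub>s D (T\<^sub>B D) \<and>
     (\<forall>T. T\<^sub>A D < T \<and> T < T\<^sub>B D \<longrightarrow>
        f\<^sub>l D (T\<^sub>A D) < f\<^sub>l D T \<and> f\<^sub>l D T < f\<^sub>s D T \<and> f\<^sub>s D T < f\<^sub>l D (T\<^sub>B D)) \<and>
     f\<^sub>l D (T\<^sub>A D) < C\<^sub>0 D \<and> C\<^sub>0 D < f\<^sub>l D (T\<^sub>B D) \<and>
     T\<^sub>A D < T\<^sub>0 D \<and> T\<^sub>0 D < T\<^sub>B D \<and>
     C\<^sub>0 D < f\<^sub>l D (T\<^sub>0 D)"

definition T\<^sub>0\<^sub>l :: "alloy \<Rightarrow> real" where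
  "T\<^sub>0\<^sub>l D = the_inv_into {T\<^sub>A D..T\<^sub>B D} (f\<^sub>l D) (C\<^sub>0 D)"

definition T\<^sub>0\<^sub>s :: "alloy \<Rightarrow> real" where
  "T\<^sub>0\<^sub>s D = the_inv_into {T\<^sub>A D..T\<^sub>B D} (f\<^sub>s D) (C\<^sub>0 D)"

definition heat_equation :: "real \<Rightarrow> (real \<Rightarrow> real \<Rightarrow> real) \<Rightarrow> (real \<times> real) set \<Rightarrow> bool" where
  "heat_equation a u \<Omega> \<longleftrightarrow>
     (\<exists>u\<^sub>x u\<^sub>x\<^sub>x u\<^sub>t. \<forall>(x, t) \<in> \<Omega>.
        ((\<lambda>y. u y t) has_real_derivative u\<^sub>x x t) (at x) \<and>
        ((\<lambda>y. u\<^sub>x y t) has_real_derivative u\<^sub>x\<^sub>x x t) (at x) \<and>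
        ((\<lambda>\<tau>. u x \<tau>) has_real_derivative u\<^sub>t x t) (at t) \<and>
        a * u\<^sub>x\<^sub>x x t = u\<^sub>t x t)"

text \<open>The conditions shared by both problems, that is, all but the condition on the temperature
  at the fixed face x = 0. Unknowns are functions of (x, t) in curried form. Boundary values are
  values of the continuous extension to the closed phase, space derivatives at the two
  boundaries are one-sided, from inside the respective phase, and the conditions at t = 0 and at
  x = infinity are limits.\<close>

definition free_boundary_conditions ::
  "alloy \<Rightarrow> (real \<Rightarrow> real) \<Rightarrow> real \<Rightarrow> (real \<Rightarrow> real \<Rightarrow> real) \<Rightarrow> (real \<Rightarrow> real \<Rightarrow> real) \<Rightarrow>
   (real \<Rightarrow> real \<Rightarrow> real) \<Rightarrow> (real \<Rightarrow> real \<Rightarrow> real) \<Rightarrow> bool" where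
  "free_boundary_conditions D s T\<^sub>k T\<^sub>s T\<^sub>l C\<^sub>s C\<^sub>l \<longleftrightarrow>
     (\<forall>t>0. 0 < s t) \<and> T\<^sub>A D < T\<^sub>k \<and> T\<^sub>k < T\<^sub>B D \<and>
     heat_equation (\<alpha>\<^sub>s D) T\<^sub>s {(x, t). 0 < t \<and> 0 < x \<and> x < s t} \<and>
     heat_equation (\<alpha>\<^sub>l D) T\<^sub>l {(x, t). 0 < t \<and> s t < x} \<and>
     heat_equation (d\<^sub>s D) C\<^sub>s {(x, t). 0 < t \<and> 0 < x \<and> x < s t} \<and>
     heat_equation (d\<^sub>l D) C\<^sub>l {(x, t). 0 < t \<and> s t < x} \<and>
     (\<forall>t>0. continuous_on {0..s t} (\<lambda>x. T\<^sub>s x t) \<and> continuous_on {s t..} (\<lambda>x. T\<^sub>l x t) \<and>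
            continuous_on {0..s t} (\<lambda>x. C\<^sub>s x t) \<and> continuous_on {s t..} (\<lambda>x. C\<^sub>l x t)) \<and>
     (\<forall>t>0. T\<^sub>s (s t) t = T\<^sub>k \<and> T\<^sub>l (s t) t = T\<^sub>k) \<and>
     (\<forall>x>0. ((\<lambda>t. T\<^sub>l x t) \<longlongrightarrow> T\<^sub>0 D) (at_right 0)) \<and>
     (\<forall>t>0. ((\<lambda>x. T\<^sub>l x t) \<longlongrightarrow> T\<^sub>0 D) at_top) \<and>
     (\<forall>t>0. ((\<lambda>x. C\<^sub>s x t) has_real_derivative 0) (at 0 within {0..s t})) \<and>
     (\<forall>t>0. C\<^sub>s (s t) t = f\<^sub>s D T\<^sub>k) \<and>
     (\<forall>x>0. ((\<lambda>t. C\<^sub>l x t) \<longlongrightarrow> C\<^sub>0 D) (at_right 0)) \<and>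
     (\<forall>t>0. C\<^sub>l (s t) t = f\<^sub>l D T\<^sub>k) \<and>
     (\<forall>t>0. \<exists>s' T\<^sub>s\<^sub>x T\<^sub>l\<^sub>x C\<^sub>s\<^sub>x C\<^sub>l\<^sub>x.
        (s has_real_derivative s') (at t) \<and>
        ((\<lambda>x. T\<^sub>s x t) has_real_derivative T\<^sub>s\<^sub>x) (at (s t) within {0..s t}) \<and>
        ((\<lambda>x. T\<^sub>l x t) has_real_derivative T\<^sub>l\<^sub>x) (at (s t) within {s t..}) \<and>
        ((\<lambda>x. C\<^sub>s x t) has_real_derivative C\<^sub>s\<^sub>x) (at (s t) within {0..s t}) \<and>
        ((\<lambda>x. C\<^sub>l x t) has_real_derivative C\<^sub>l\<^sub>x) (at (s t) within {s t..}) \<and>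
        k\<^sub>s D * T\<^sub>s\<^sub>x - k\<^sub>l D * T\<^sub>l\<^sub>x = \<gamma> D * \<rho> D * s' \<and>
        d\<^sub>l D * C\<^sub>l\<^sub>x - d\<^sub>s D * C\<^sub>s\<^sub>x = (f\<^sub>s D T\<^sub>k - f\<^sub>l D T\<^sub>k) * s')"

definition solves_P\<^sub>2 ::
  "alloy \<Rightarrow> real \<Rightarrow> (real \<Rightarrow> real) \<Rightarrow> real \<Rightarrow> (real \<Rightarrow> real \<Rightarrow> real) \<Rightarrow> (real \<Rightarrow> real \<Rightarrow> real) \<Rightarrow>
   (real \<Rightarrow> real \<Rightarrow> real) \<Rightarrow> (real \<Rightarrow> real \<Rightarrow> real) \<Rightarrow> bool" where
  "solves_P\<^sub>2 D h\<^sub>0 s T\<^sub>k T\<^sub>s T\<^sub>l C\<^sub>s C\<^sub>l \<longleftrightarrow>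
     free_boundary_conditions D s T\<^sub>k T\<^sub>s T\<^sub>l C\<^sub>s C\<^sub>l \<and>
     (\<forall>t>0. \<exists>T\<^sub>s\<^sub>x. ((\<lambda>x. T\<^sub>s x t) has_real_derivative T\<^sub>s\<^sub>x) (at 0 within {0..s t}) \<and>
        k\<^sub>s D * T\<^sub>s\<^sub>x = h\<^sub>0 / sqrt t * (T\<^sub>s 0 t - T_bulk D))"

definition solves_P\<^sub>R ::
  "alloy \<Rightarrow> real \<Rightarrow> (real \<Rightarrow> real) \<Rightarrow> real \<Rightarrow> (real \<Rightarrow> real \<Rightarrow> real) \<Rightarrow> (real \<Rightarrow> real \<Rightarrow> real) \<Rightarrow>
   (real \<Rightarrow> real \<Rightarrow> real) \<Rightarrow> (real \<Rightarrow> real \<Rightarrow> real) \<Rightarrow> bool" where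
  "solves_P\<^sub>R D T\<^sub>1 s T\<^sub>k T\<^sub>s T\<^sub>l C\<^sub>s C\<^sub>l \<longleftrightarrow>
     free_boundary_conditions D s T\<^sub>k T\<^sub>s T\<^sub>l C\<^sub>s C\<^sub>l \<and>
     (\<forall>t>0. T\<^sub>s 0 t = T\<^sub>1)"

definition Q :: "real \<Rightarrow> real" where
  "Q x = sqrt pi * x * exp (x\<^sup>2) * erfc x"

definition Q\<^sub>1 :: "real \<Rightarrow> real" where
  "Q\<^sub>1 x = sqrt pi * x * exp (x\<^sup>2) * erf x"

definition F\<^sub>1 :: "real \<Rightarrow> real" where
  "F\<^sub>1 x = exp (x\<^sup>2) * erfc x"

definition c_ratio :: "alloy \<Rightarrow> real" where
  "c_ratio D = sqrt (\<alpha>\<^sub>s D / \<alpha>\<^sub>l D)"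

definition M :: "alloy \<Rightarrow> real \<Rightarrow> real" where
  "M D x = inverse (Q (sqrt (\<alpha>\<^sub>s D / d\<^sub>l D) * x))"

definition F\<^sub>2 :: "alloy \<Rightarrow> real \<Rightarrow> real \<Rightarrow> real" where
  "F\<^sub>2 D h\<^sub>0 x =
     h\<^sub>0 * k\<^sub>s D * sqrt (pi * \<alpha>\<^sub>l D) * exp (- x\<^sup>2) * F\<^sub>1 (c_ratio D * x) /
     (k\<^sub>l D * (k\<^sub>s D + h\<^sub>0 * sqrt (pi * \<alpha>\<^sub>s D) * erf x))"

definition H :: "alloy \<Rightarrow> real \<Rightarrow> real \<Rightarrow> real" where
  "H D h\<^sub>0 x =
     h\<^sub>0 * k\<^sub>s D * sqrt (pi * \<alpha>\<^sub>l D) /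
       (x * exp (x\<^sup>2) * (k\<^sub>s D + h\<^sub>0 * sqrt (pi * \<alpha>\<^sub>s D) * erf x)) +
     k\<^sub>l D * sqrt (pi * \<alpha>\<^sub>s D) / (sqrt (\<alpha>\<^sub>l D) * Q (c_ratio D * x))"

definition W :: "alloy \<Rightarrow> real \<Rightarrow> real \<Rightarrow> real" where
  "W D h\<^sub>0 x =
     T_bulk D + (T\<^sub>0 D - T_bulk D) / (F\<^sub>2 D h\<^sub>0 x + 1) +
     \<gamma> D * \<rho> D * sqrt (pi * \<alpha>\<^sub>s D * \<alpha>\<^sub>l D) / H D h\<^sub>0 x"

definition G :: "alloy \<Rightarrow> real \<Rightarrow> real \<Rightarrow> real" where
  "G D T\<^sub>1 x =
     (\<gamma> D * \<rho> D * \<alpha>\<^sub>s D * \<alpha>\<^sub>l D * Q\<^sub>1 x * Q (c_ratio D * x) +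
      T\<^sub>1 * k\<^sub>s D * \<alpha>\<^sub>l D * Q (c_ratio D * x) + T\<^sub>0 D * k\<^sub>l D * \<alpha>\<^sub>s D * Q\<^sub>1 x) /
     (k\<^sub>s D * \<alpha>\<^sub>l D * Q (c_ratio D * x) + k\<^sub>l D * \<alpha>\<^sub>s D * Q\<^sub>1 x)"

definition \<phi> :: "alloy \<Rightarrow> real \<Rightarrow> real" where
  "\<phi> D T = (f\<^sub>s D T - f\<^sub>l D T) / (C\<^sub>0 D - f\<^sub>l D T)"

text \<open>The pairs that parametrise the two solutions. The function \<open>\<phi>\<close> is not
  defined where its denominator vanishes, hence the condition that the phase-change temperature
  differs from that point.\<close>

definition similarity_pair :: "alloy \<Rightarrow> real \<Rightarrow> real \<Rightarrow> real \<Rightarrow> bool" where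
  "similarity_pair D h\<^sub>0 \<delta> T\<^sub>k \<longleftrightarrow>
     0 < \<delta> \<and> T\<^sub>A D < T\<^sub>k \<and> T\<^sub>k < T\<^sub>B D \<and> T\<^sub>k \<noteq> T\<^sub>0\<^sub>l D \<and>
     T\<^sub>k = W D h\<^sub>0 \<delta> \<and> M D \<delta> = \<phi> D T\<^sub>k"

definition rubinstein_pair :: "alloy \<Rightarrow> real \<Rightarrow> real \<Rightarrow> real \<Rightarrow> bool" where
  "rubinstein_pair D T\<^sub>1 \<mu> T\<^sub>k \<longleftrightarrow>
     0 < \<mu> \<and> T\<^sub>A D < T\<^sub>k \<and> T\<^sub>k < T\<^sub>B D \<and> T\<^sub>k \<noteq> T\<^sub>0\<^sub>l D \<and>
     T\<^sub>k = G D T\<^sub>1 \<mu> \<and> M D \<mu> = \<phi> D T\<^sub>k"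

text \<open>The free boundary, the liquid temperature and the two concentrations are given by the same
  formulas in both solutions, evaluated at the respective pair; the two solid temperatures have
  different formulas. All these are total functions; the physically meaningful domain is t > 0
  together with 0 < x < front (solid) or x > front (liquid).\<close>

definition front :: "alloy \<Rightarrow> real \<Rightarrow> real \<Rightarrow> real" where
  "front D \<delta> t = 2 * \<delta> * sqrt (\<alpha>\<^sub>s D * t)"

definition similarity_T\<^sub>s :: "alloy \<Rightarrow> real \<Rightarrow> real \<Rightarrow> real \<Rightarrow> real \<Rightarrow> real \<Rightarrow> real" where
  "similarity_T\<^sub>s D h\<^sub>0 \<delta> T\<^sub>k x t =
     T\<^sub>k + h\<^sub>0 * sqrt (pi * \<alpha>\<^sub>s D) * (T\<^sub>k - T_bulk D) /
            (k\<^sub>s D + h\<^sub>0 * sqrt (pi * \<alpha>\<^sub>s D) * erf \<delta>) *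
          (erf (x / (2 * sqrt (\<alpha>\<^sub>s D * t))) - erf \<delta>)"

definition rubinstein_T\<^sub>s :: "alloy \<Rightarrow> real \<Rightarrow> real \<Rightarrow> real \<Rightarrow> real \<Rightarrow> real \<Rightarrow> real" where
  "rubinstein_T\<^sub>s D T\<^sub>1 \<mu> T\<^sub>k x t =
     T\<^sub>1 + (T\<^sub>k - T\<^sub>1) / erf \<mu> * erf (x / (2 * sqrt (\<alpha>\<^sub>s D * t)))"

definition liquid_T :: "alloy \<Rightarrow> real \<Rightarrow> real \<Rightarrow> real \<Rightarrow> real \<Rightarrow> real" where
  "liquid_T D \<delta> T\<^sub>k x t =
     T\<^sub>0 D + (T\<^sub>k - T\<^sub>0 D) / erfc (c_ratio D * \<delta>) * erfc (x / (2 * sqrt (\<alpha>\<^sub>l D * t)))"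

definition solid_C :: "alloy \<Rightarrow> real \<Rightarrow> real \<Rightarrow> real \<Rightarrow> real" where
  "solid_C D T\<^sub>k x t = f\<^sub>s D T\<^sub>k"

definition liquid_C :: "alloy \<Rightarrow> real \<Rightarrow> real \<Rightarrow> real \<Rightarrow> real \<Rightarrow> real" where
  "liquid_C D \<delta> T\<^sub>k x t =
     C\<^sub>0 D + (f\<^sub>l D T\<^sub>k - C\<^sub>0 D) / erfc (sqrt (\<alpha>\<^sub>s D / d\<^sub>l D) * \<delta>) *
             erfc (x / (2 * sqrt (d\<^sub>l D * t)))"

definition face_temperature :: "alloy \<Rightarrow> real \<Rightarrow> real \<Rightarrow> real \<Rightarrow> real" where
  "face_temperature D h\<^sub>0 \<delta> T\<^sub>k =
     T\<^sub>k - h\<^sub>0 * sqrt (pi * \<alpha>\<^sub>s D) * erf \<delta> * (T\<^sub>k - T_bulk D) /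
            (k\<^sub>s D + h\<^sub>0 * sqrt (pi * \<alpha>\<^sub>s D) * erf \<delta>)"

end

theory Submission
  imports Defs "HOL-Probability.Distributions" "HOL-Real_Asymp.Real_Asymp"
begin

text \<open>Both solutions consist of profiles \<open>A + B * erf (x / (2 * sqrt (a * t)))\<close>, on which
  every condition at the front \<open>x = 2 * \<delta> * sqrt (\<alpha>\<^sub>s * t)\<close> becomes a relation between
  numbers. After multiplication by \<open>sqrt t\<close>, the heat balance at the front reads
  \<open>p * (T\<^sub>k - a) + r * (T\<^sub>k - T\<^sub>0) = l\<close>: here \<open>r\<close> is the conductance of the
  liquid, \<open>l\<close> the latent heat released by the moving front, and the pair \<open>(p, a)\<close> describes the
  solid, either through the bulk temperature and the convective face or through the face
  temperature \<open>T\<^sub>1\<close>. Solving this balance for \<open>T\<^sub>k\<close> gives \<open>W\<close> in the first case and \<open>G\<close> in the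
  second (\<open>W_iff_balance\<close>, \<open>G_iff_balance\<close>). The equation \<open>M \<delta> = \<phi> T\<^sub>k\<close> is the solute balance. This
  is why the explicit formulas solve the free boundary problems.

  If \<open>T\<^sub>1\<close> is the face temperature of the convective solution, the two descriptions of the solid
  yield the same heat flux at the front (\<open>face_temperature_equal_flux\<close>), so \<open>(\<delta>, T\<^sub>k)\<close> is also
  a Rubinstein pair. It is the only one. Since \<open>M > 1\<close>, a solution of \<open>M \<mu> = \<phi> T\<close> satisfies
  \<open>f\<^sub>l T < C\<^sub>0 < f\<^sub>s T\<close>, and on such \<open>T\<close> the function \<open>\<phi>\<close> is strictly increasing. The function \<open>M\<close> is
  strictly decreasing, and \<open>G\<close> is strictly increasing provided \<open>T\<^sub>1 < T\<^sub>0\<close>; hence \<open>M \<mu> = \<phi> (G \<mu>)\<close> has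
  at most one solution. The proviso holds because the upper bound on \<open>h\<^sub>0\<close> forces the bulk temperature
  below \<open>T\<^sub>0\<^sub>s\<close>, so that \<open>T_bulk < T\<^sub>0\<^sub>s < T\<^sub>k < T\<^sub>0\<close>, and the face is colder than the front.

  The monotonicity of \<open>M\<close> and \<open>G\<close> comes from that of \<open>Q\<close> and \<open>F\<^sub>1\<close>, which in turn comes from the
  two-sided bound of Mills' ratio type on \<open>erfc\<close> in \<open>erfc_less\<close> and \<open>erfc_greater\<close>.\<close>

section \<open>The error function\<close>

lemma erf_deriv: "(erf has_real_derivative 2 / sqrt pi * exp (- x\<^sup>2)) (at x)"
proof -
  define I :: "real \<Rightarrow> real" where "I u = (LBINT t=ereal 0..ereal u. exp (- t\<^sup>2))" for u
  \<comment> \<open>The fundamental theorem is stated relative to a compact interval; this one has both 0 and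
    \<open>x\<close> in its interior.\<close>
  let ?J = "{- \<bar>x\<bar> - 1..\<bar>x\<bar> + 1}"
  have "(I has_vector_derivative exp (- x\<^sup>2)) (at x within ?J)"
    unfolding I_def by (rule interval_integral_FTC2) (auto intro!: continuous_intros)
  moreover have "x \<in> interior ?J"
    unfolding interior_atLeastAtMost_real greaterThanLessThan_iff by linarith
  ultimately have "(I has_real_derivative exp (- x\<^sup>2)) (at x)"
    unfolding has_real_derivative_iff_has_vector_derivative by (metis at_within_interior)
  then have "((\<lambda>u. 2 / sqrt pi * I u) has_real_derivative 2 / sqrt pi * exp (- x\<^sup>2)) (at x)"
    by (rule DERIV_cmult)
  then show ?thesis
    unfolding erf_def[abs_def] I_def zero_ereal_def .
qed

lemma erf_deriv_comp [derivative_intros]: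
  assumes "(g has_real_derivative d) (at x within S)"
  shows "((\<lambda>x. erf (g x)) has_real_derivative 2 / sqrt pi * exp (- (g x)\<^sup>2) * d) (at x within S)"
  by (rule DERIV_chain2[OF erf_deriv assms])

lemma erfc_deriv_comp [derivative_intros]:
  assumes "(g has_real_derivative d) (at x within S)"
  shows "((\<lambda>x. erfc (g x)) has_real_derivative - (2 / sqrt pi * exp (- (g x)\<^sup>2) * d)) (at x within S)"
  unfolding erfc_def using DERIV_diff[OF DERIV_const erf_deriv_comp[OF assms], of 1] by simp

lemma erf_0 [simp]: "erf 0 = 0"
  by (simp add: erf_def zero_ereal_def[symmetric])

lemma erf_strict_mono: "strict_mono erf"
proof (rule strict_monoI, rule DERIV_pos_imp_increasing[where f = erf])
  fix x :: real
  show "\<exists>D. DERIV erf x :> D \<and> 0 < D"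
    by (rule exI, rule conjI, rule erf_deriv) simp
qed

lemma erf_pos: "0 < x \<Longrightarrow> 0 < erf x"
  using strict_monoD[OF erf_strict_mono, of 0 x] by simp

text \<open>The Gaussian integral over the positive half-line.\<close>

lemma erf_tendsto_1: "(erf \<longlongrightarrow> 1) at_top"
proof -
  let ?f = "\<lambda>x::real. indicator {0..} x *\<^sub>R exp (- x\<^sup>2)"
  have int: "integrable lborel ?f" and val: "integral\<^sup>L lborel ?f = sqrt pi / 2"
    using gaussian_moment_0 unfolding has_bochner_integral_iff by blast+
  have "((\<lambda>y. \<integral>x. indicator {..y} x *\<^sub>R ?f x \<partial>lborel) \<longlongrightarrow> sqrt pi / 2) at_top"
    using tendsto_integral_at_top[OF sets_lborel int] unfolding val .
  then have "((\<lambda>y. 2 / sqrt pi * (\<integral>x. indicator {..y} x *\<^sub>R ?f x \<partial>lborel))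
      \<longlongrightarrow> 2 / sqrt pi * (sqrt pi / 2)) at_top"
    by (rule tendsto_mult_left)
  moreover have "\<forall>\<^sub>F y in at_top. 2 / sqrt pi * (\<integral>x. indicator {..y} x *\<^sub>R ?f x \<partial>lborel) = erf y"
    using eventually_ge_at_top[of 0]
  proof eventually_elim
    case (elim y)
    have "(\<integral>x. indicator {..y} x *\<^sub>R ?f x \<partial>lborel) = (LBINT x:{0..y}. exp (- x\<^sup>2))"
      unfolding set_lebesgue_integral_def
      by (rule Bochner_Integration.integral_cong) (auto simp: indicator_def)
    also have "\<dots> = (LBINT x=0..y. exp (- x\<^sup>2))"
      using interval_integral_Icc[OF elim, of "\<lambda>x. exp (- x\<^sup>2)"] by (simp add: zero_ereal_def)
    finally show ?case by (simp add: erf_def)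
  qed
  ultimately show ?thesis
    by (simp add: tendsto_cong)
qed

lemma erfc_tendsto_0: "(erfc \<longlongrightarrow> 0) at_top"
  unfolding erfc_def[abs_def] using tendsto_diff[OF tendsto_const erf_tendsto_1, of 1] by simp

lemma erfc_pos: "0 < erfc x"
proof (rule DERIV_neg_imp_decreasing_at_top[OF _ erfc_tendsto_0])
  fix y
  show "\<exists>D. DERIV erfc y :> D \<and> D < 0"
    by (rule exI, rule conjI, rule erfc_deriv_comp[OF DERIV_ident]) simp
qed

text \<open>The difference of the two sides, divided by \<open>sqrt pi * x\<close>, is strictly decreasing and vanishes at
  infinity, hence is positive.\<close>

lemma erfc_less:
  assumes "0 < x"
  shows "sqrt pi * x * erfc x < exp (- x\<^sup>2)"
proof -
  let ?f = "\<lambda>x. 1 / sqrt pi * (exp (- x\<^sup>2) / x) - erfc x"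
  have "\<exists>D. DERIV ?f y :> D \<and> D < 0" if "x \<le> y" for y
  proof (intro exI conjI)
    have "DERIV (\<lambda>x. exp (- x\<^sup>2) / x) y :> - 2 * exp (- y\<^sup>2) - exp (- y\<^sup>2) / y\<^sup>2"
      using assms that
      by (auto intro!: derivative_eq_intros simp: field_simps power2_eq_square)
    from DERIV_diff[OF DERIV_cmult[OF this, of "1 / sqrt pi"] erfc_deriv_comp[OF DERIV_ident]]
    show "DERIV ?f y :> - (1 / sqrt pi * (exp (- y\<^sup>2) / y\<^sup>2))"
      by (simp add: algebra_simps diff_divide_distrib)
    show "- (1 / sqrt pi * (exp (- y\<^sup>2) / y\<^sup>2)) < 0"
      using assms that by simp
  qed
  moreover have "(?f \<longlongrightarrow> 0 - 0) at_top"
  proof (rule tendsto_diff[OF _ erfc_tendsto_0])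
    show "((\<lambda>x. 1 / sqrt pi * (exp (- x\<^sup>2) / x)) \<longlongrightarrow> 0) at_top" by real_asymp
  qed
  ultimately have "0 < ?f x"
    using DERIV_neg_imp_decreasing_at_top[of x ?f 0] by simp
  then show ?thesis
    using assms by (simp add: field_simps)
qed

text \<open>The same argument, applied to \<open>erfc x - 2 / sqrt pi * x * exp (- x\<^sup>2) / (1 + 2 * x\<^sup>2)\<close>. This rational
  factor is chosen because the bound is exactly the positivity of the derivative of \<open>Q\<close>.\<close>

lemma erfc_greater:
  "2 * x * exp (- x\<^sup>2) < sqrt pi * (1 + 2 * x\<^sup>2) * erfc x"
proof -
  let ?g = "\<lambda>x::real. x * exp (- x\<^sup>2) / (1 + 2 * x\<^sup>2)"
  let ?f = "\<lambda>x. erfc x - 2 / sqrt pi * ?g x"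
  have pos: "0 < 1 + 2 * y\<^sup>2" for y :: real
    using zero_le_power2[of y] by linarith
  have "\<exists>D. DERIV ?f y :> D \<and> D < 0" for y
  proof (intro exI conjI)
    have nz: "1 + 2 * y\<^sup>2 \<noteq> 0" using pos[of y] by simp
    then have "DERIV ?g y :> ((exp (- y\<^sup>2) - 2 * y\<^sup>2 * exp (- y\<^sup>2)) * (1 + 2 * y\<^sup>2)
          - y * exp (- y\<^sup>2) * (4 * y)) / (1 + 2 * y\<^sup>2)\<^sup>2"
      by (auto intro!: derivative_eq_intros simp: power2_eq_square algebra_simps)
    also have "((exp (- y\<^sup>2) - 2 * y\<^sup>2 * exp (- y\<^sup>2)) * (1 + 2 * y\<^sup>2)
          - y * exp (- y\<^sup>2) * (4 * y)) / (1 + 2 * y\<^sup>2)\<^sup>2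
        = exp (- y\<^sup>2) * (2 / (1 + 2 * y\<^sup>2)\<^sup>2 - 1)"
      using nz by (simp add: field_simps)
        (simp add: power2_eq_square power4_eq_xxxx algebra_simps)
    finally have "DERIV ?g y :> exp (- y\<^sup>2) * (2 / (1 + 2 * y\<^sup>2)\<^sup>2 - 1)" .
    from DERIV_diff[OF erfc_deriv_comp[OF DERIV_ident] DERIV_cmult[OF this, of "2 / sqrt pi"]]
    show "DERIV ?f y :> - (2 / sqrt pi * exp (- y\<^sup>2) * (2 / (1 + 2 * y\<^sup>2)\<^sup>2))"
      by (simp add: algebra_simps diff_divide_distrib)
    show "- (2 / sqrt pi * exp (- y\<^sup>2) * (2 / (1 + 2 * y\<^sup>2)\<^sup>2)) < 0"
      using nz by simp
  qed
  moreover have "(?f \<longlongrightarrow> 0 - 0) at_top"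
  proof (rule tendsto_diff[OF erfc_tendsto_0])
    show "((\<lambda>x. 2 / sqrt pi * ?g x) \<longlongrightarrow> 0) at_top" by real_asymp
  qed
  ultimately have "0 < ?f x"
    using DERIV_neg_imp_decreasing_at_top[of x ?f 0] by simp
  then have "2 * x * exp (- x\<^sup>2) / (sqrt pi * (1 + 2 * x\<^sup>2)) < erfc x"
    by (simp add: mult.assoc)
  then show ?thesis
    using pos[of x] by (subst (asm) pos_divide_less_eq) (simp_all add: mult_ac)
qed

section \<open>Monotonicity of Q and of the scaled complementary error function\<close>

lemma F\<^sub>1_pos: "0 < F\<^sub>1 x"
  by (simp add: F\<^sub>1_def erfc_pos)

lemma Q_F\<^sub>1: "Q x = sqrt pi * x * F\<^sub>1 x"
  by (simp add: Q_def F\<^sub>1_def)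

lemma Q_pos: "0 < x \<Longrightarrow> 0 < Q x"
  by (simp add: Q_F\<^sub>1 F\<^sub>1_pos)

lemma Q_less_1: "0 < x \<Longrightarrow> Q x < 1"
  using erfc_less[of x] by (simp add: Q_def exp_minus field_simps)

lemma Q_strict_mono: "strict_mono Q"
proof (rule strict_monoI, rule DERIV_pos_imp_increasing[where f = Q])
  fix x :: real
  have e: "exp (- x\<^sup>2) * exp (x\<^sup>2) = 1"
    by (simp flip: exp_add)
  show "\<exists>D. DERIV Q x :> D \<and> 0 < D"
  proof (intro exI conjI)
    show "DERIV Q x :> sqrt pi * (1 + 2 * x\<^sup>2) * erfc x * exp (x\<^sup>2) - 2 * x"
      unfolding Q_def[abs_def] using e
      by (auto intro!: derivative_eq_intros simp: power2_eq_square algebra_simps)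
    have "2 * x * exp (- x\<^sup>2) * exp (x\<^sup>2) < sqrt pi * (1 + 2 * x\<^sup>2) * erfc x * exp (x\<^sup>2)"
      using erfc_greater by (rule mult_strict_right_mono) simp
    then show "0 < sqrt pi * (1 + 2 * x\<^sup>2) * erfc x * exp (x\<^sup>2) - 2 * x"
      by (simp add: mult.assoc e)
  qed
qed

text \<open>The derivative is \<open>2 / sqrt pi * (Q x - 1)\<close>, so the bound \<open>Q < 1\<close> decides its sign.\<close>

lemma F\<^sub>1_strict_antimono:
  assumes "0 < x" "x < y"
  shows "F\<^sub>1 y < F\<^sub>1 x"
proof (rule DERIV_neg_imp_decreasing[OF assms(2)])
  fix z assume "x \<le> z"
  show "\<exists>D. DERIV F\<^sub>1 z :> D \<and> D < 0"
  proof (intro exI conjI)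
    have "exp (z\<^sup>2) * exp (- z\<^sup>2) = 1"
      by (simp flip: exp_add)
    then show "DERIV F\<^sub>1 z :> 2 / sqrt pi * (Q z - 1)"
      unfolding F\<^sub>1_def[abs_def] Q_def
      by (auto intro!: derivative_eq_intros simp: field_simps)
    show "2 / sqrt pi * (Q z - 1) < 0"
      using Q_less_1[of z] assms(1) \<open>x \<le> z\<close> by (intro mult_pos_neg) simp_all
  qed
qed

section \<open>Self-similar solutions of the heat equation\<close>

definition self_similar :: "real \<Rightarrow> real \<Rightarrow> real \<Rightarrow> real \<Rightarrow> real \<Rightarrow> real" where
  "self_similar a A B x t = A + B * erf (x / (2 * sqrt (a * t)))"

lemma self_similar_deriv_x:
  assumes "0 < a" "0 < t"
  shows "((\<lambda>x. self_similar a A B x t) has_real_derivative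
           B / sqrt (pi * (a * t)) * exp (- (x / (2 * sqrt (a * t)))\<^sup>2)) (at x within S)"
  using assms unfolding self_similar_def
  by (auto intro!: derivative_eq_intros simp: real_sqrt_mult field_simps)

lemma self_similar_heat_equation:
  assumes "0 < a" and \<Omega>: "\<And>x t. (x, t) \<in> \<Omega> \<Longrightarrow> 0 < t"
  shows "heat_equation a (self_similar a A B) \<Omega>"
  unfolding heat_equation_def
proof (intro exI ballI, clarify, intro conjI)
  fix x t assume "(x, t) \<in> \<Omega>"
  then have t: "0 < t" by (rule \<Omega>)
  let ?E = "exp (- (x / (2 * sqrt (a * t)))\<^sup>2)"
  let ?u\<^sub>x = "\<lambda>x t. B / sqrt (pi * (a * t)) * exp (- (x / (2 * sqrt (a * t)))\<^sup>2)"
  show "((\<lambda>y. self_similar a A B y t) has_real_derivative ?u\<^sub>x x t) (at x)"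
    using assms(1) t by (rule self_similar_deriv_x)
  show "((\<lambda>y. ?u\<^sub>x y t) has_real_derivative
      (\<lambda>x t. - (x / (2 * (a * t))) * ?u\<^sub>x x t) x t) (at x)"
    using assms(1) t
    by (auto intro!: derivative_eq_intros simp: field_simps power2_eq_square)
  show "((\<lambda>\<tau>. self_similar a A B x \<tau>) has_real_derivative
      (\<lambda>x t. - (x / (2 * t)) * ?u\<^sub>x x t) x t) (at t)"
    using assms(1) t unfolding self_similar_def
    by (auto intro!: derivative_eq_intros simp: real_sqrt_mult field_simps power2_eq_square)
  show "a * (- (x / (2 * (a * t))) * ?u\<^sub>x x t) = - (x / (2 * t)) * ?u\<^sub>x x t"
    using assms(1) t by (simp add: field_simps)
qed

lemma self_similar_continuous:
  assumes "0 < a" "0 < t"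
  shows "continuous_on S (\<lambda>x. self_similar a A B x t)"
  by (rule DERIV_continuous_on) (rule self_similar_deriv_x[OF assms])

lemma self_similar_at_infinity:
  assumes "0 < a" "0 < t"
  shows "((\<lambda>x. self_similar a A B x t) \<longlongrightarrow> A + B) at_top"
proof -
  define q where "q = 2 * sqrt (a * t)"
  have "0 < q" using assms by (simp add: q_def)
  then have "filterlim (\<lambda>x. x / q) at_top at_top"
    by real_asymp
  from tendsto_add[OF tendsto_const tendsto_mult_left[OF filterlim_compose[OF erf_tendsto_1 this]], of A B]
  show ?thesis by (simp add: self_similar_def q_def)
qed

text \<open>For fixed \<open>x\<close> the similarity variable tends to infinity also as \<open>t\<close> decreases to 0, so the initial
  value is the value at infinity.\<close>

lemma self_similar_initially:
  assumes "0 < a" "0 < x"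
  shows "((\<lambda>t. self_similar a A B x t) \<longlongrightarrow> A + B) (at_right 0)"
proof -
  have "filterlim (\<lambda>t. x / (2 * sqrt (a * t))) at_top (at_right 0)"
    using assms by real_asymp
  from tendsto_add[OF tendsto_const tendsto_mult_left[OF filterlim_compose[OF erf_tendsto_1 this]], of A B]
  show ?thesis by (simp add: self_similar_def)
qed

section \<open>Heat balance at the front\<close>

text \<open>Heat fluxes at the front \<open>2 * x * sqrt (\<alpha>\<^sub>s * t)\<close> decay like \<open>1 / sqrt t\<close>. The three conductances are
  the factors by which a temperature difference has to be multiplied to obtain such a flux times
  \<open>sqrt t\<close>: \<open>T\<^sub>k - T\<^sub>0\<close> for the flux into the liquid, and, for the flux from the front into the solid,
  \<open>T\<^sub>k - T\<^sub>1\<close> if the face has temperature \<open>T\<^sub>1\<close> and \<open>T\<^sub>k - T_bulk\<close> if the face is cooled by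
  convection. The latent flux is the rate \<open>\<gamma> * \<rho> * s' t\<close> times \<open>sqrt t\<close>.\<close>

definition liquid_conductance :: "alloy \<Rightarrow> real \<Rightarrow> real" where
  "liquid_conductance D x = k\<^sub>l D / (sqrt (pi * \<alpha>\<^sub>l D) * F\<^sub>1 (c_ratio D * x))"

definition solid_conductance :: "alloy \<Rightarrow> real \<Rightarrow> real" where
  "solid_conductance D x = k\<^sub>s D * exp (- x\<^sup>2) / (sqrt (pi * \<alpha>\<^sub>s D) * erf x)"

definition convective_conductance :: "alloy \<Rightarrow> real \<Rightarrow> real \<Rightarrow> real" where
  "convective_conductance D h\<^sub>0 x =
     h\<^sub>0 * k\<^sub>s D * exp (- x\<^sup>2) / (k\<^sub>s D + h\<^sub>0 * sqrt (pi * \<alpha>\<^sub>s D) * erf x)"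

definition latent_flux :: "alloy \<Rightarrow> real \<Rightarrow> real" where
  "latent_flux D x = \<gamma> D * \<rho> D * sqrt (\<alpha>\<^sub>s D) * x"

lemma alloy_data_pos:
  assumes "alloy_data D"
  shows "0 < \<alpha>\<^sub>s D" "0 < \<alpha>\<^sub>l D" "0 < d\<^sub>s D" "0 < d\<^sub>l D" "0 < k\<^sub>s D" "0 < k\<^sub>l D" "0 < \<rho> D" "0 < \<gamma> D"
    "0 < c_ratio D"
  using assms by (auto simp: alloy_data_def c_ratio_def)

lemma conductance_pos:
  assumes "alloy_data D" "0 < x"
  shows "0 < liquid_conductance D x" "0 < solid_conductance D x"
    "0 < h\<^sub>0 \<Longrightarrow> 0 < convective_conductance D h\<^sub>0 x"
  using alloy_data_pos[OF assms(1)] erf_pos[OF assms(2)] F\<^sub>1_pos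
  by (auto simp: liquid_conductance_def solid_conductance_def convective_conductance_def
      intro!: divide_pos_pos mult_pos_pos add_pos_pos)

lemma weighted_mean_iff_balance:
  fixes p r :: real
  assumes "0 < p" "0 < r"
  shows "T = (p * a + r * b + l) / (p + r) \<longleftrightarrow> p * (T - a) + r * (T - b) = l"
  using assms add_pos_pos[OF assms] by (auto simp: field_simps)

lemma F\<^sub>2_conductance:
  "F\<^sub>2 D h\<^sub>0 x = convective_conductance D h\<^sub>0 x / liquid_conductance D x"
  by (simp add: F\<^sub>2_def convective_conductance_def liquid_conductance_def mult_ac)

lemma H_conductance:
  assumes "alloy_data D" "0 < x"
  shows "H D h\<^sub>0 x = sqrt (pi * \<alpha>\<^sub>l D) / x * (convective_conductance D h\<^sub>0 x + liquid_conductance D x)"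
proof -
  note pos = alloy_data_pos[OF assms(1)]
  have "k\<^sub>l D * sqrt (pi * \<alpha>\<^sub>s D) / (sqrt (\<alpha>\<^sub>l D) * Q (c_ratio D * x))
      = sqrt (pi * \<alpha>\<^sub>l D) / x * liquid_conductance D x"
    using pos F\<^sub>1_pos[of "c_ratio D * x"] assms(2)
    by (simp add: Q_F\<^sub>1 liquid_conductance_def real_sqrt_mult)
       (simp add: c_ratio_def real_sqrt_divide field_simps)
  moreover have "h\<^sub>0 * k\<^sub>s D * sqrt (pi * \<alpha>\<^sub>l D) /
       (x * exp (x\<^sup>2) * (k\<^sub>s D + h\<^sub>0 * sqrt (pi * \<alpha>\<^sub>s D) * erf x))
      = sqrt (pi * \<alpha>\<^sub>l D) / x * convective_conductance D h\<^sub>0 x"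
    by (simp add: convective_conductance_def exp_minus divide_inverse)
  ultimately show ?thesis
    by (simp add: H_def distrib_left)
qed

lemma W_iff_balance:
  assumes "alloy_data D" "0 < h\<^sub>0" "0 < x"
  shows "T = W D h\<^sub>0 x \<longleftrightarrow>
    convective_conductance D h\<^sub>0 x * (T - T_bulk D) + liquid_conductance D x * (T - T\<^sub>0 D) = latent_flux D x"
proof -
  note pos = alloy_data_pos[OF assms(1)]
  define p where "p = convective_conductance D h\<^sub>0 x"
  define r where "r = liquid_conductance D x"
  have pr: "0 < p" "0 < r"
    using conductance_pos[OF assms(1,3)] assms(2) by (auto simp: p_def r_def)
  have "\<gamma> D * \<rho> D * sqrt (pi * \<alpha>\<^sub>s D * \<alpha>\<^sub>l D) / H D h\<^sub>0 x = latent_flux D x / (p + r)"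
    unfolding H_conductance[OF assms(1,3)] p_def[symmetric] r_def[symmetric] latent_flux_def
    using pos assms(3) pr by (simp add: real_sqrt_mult)
  then have "W D h\<^sub>0 x = T_bulk D + (T\<^sub>0 D - T_bulk D) / (p / r + 1) + latent_flux D x / (p + r)"
    unfolding W_def F\<^sub>2_conductance p_def[symmetric] r_def[symmetric] by simp
  also have "\<dots> = (p * T_bulk D + r * T\<^sub>0 D + latent_flux D x) / (p + r)"
  proof -
    have "p / r + 1 = (p + r) / r" and nz: "p + r \<noteq> 0"
      using pr by (simp_all add: field_simps)
    then have "(T\<^sub>0 D - T_bulk D) / (p / r + 1) = (T\<^sub>0 D - T_bulk D) * r / (p + r)"
      by simp
    then show ?thesis
      using nz by (simp add: add_divide_eq_iff algebra_simps flip: add_divide_distrib)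
  qed
  finally have W_mean: "W D h\<^sub>0 x = (p * T_bulk D + r * T\<^sub>0 D + latent_flux D x) / (p + r)" .
  show ?thesis
    unfolding W_mean weighted_mean_iff_balance[OF pr] by (simp only: p_def r_def)
qed

text \<open>Multiplying numerator and denominator of \<open>G\<close> by
  \<open>sqrt \<alpha>\<^sub>s * x / (\<alpha>\<^sub>s * \<alpha>\<^sub>l * Q\<^sub>1 x * Q (c * x))\<close> turns the coefficients of \<open>T\<^sub>1\<close> and \<open>T\<^sub>0\<close> into the
  two conductances. Naming the square roots makes the comparison a rational identity.\<close>

lemma G_mean:
  assumes "alloy_data D" "0 < x"
  shows "G D T\<^sub>1 x =
    (solid_conductance D x * T\<^sub>1 + liquid_conductance D x * T\<^sub>0 D + latent_flux D x) /
    (solid_conductance D x + liquid_conductance D x)"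
proof -
  note pos = alloy_data_pos[OF assms(1)]
  define p ss sl f e E where "p = sqrt pi" and "ss = sqrt (\<alpha>\<^sub>s D)" and "sl = sqrt (\<alpha>\<^sub>l D)"
    and "f = F\<^sub>1 (c_ratio D * x)" and "e = exp (x\<^sup>2)" and "E = erf x"
  note defs = this
  have dpos: "0 < p" "0 < ss" "0 < sl" "0 < f" "0 < e" "0 < E"
    using pos F\<^sub>1_pos erf_pos[OF assms(2)] by (auto simp: defs)
  have as: "\<alpha>\<^sub>s D = ss * ss" and al: "\<alpha>\<^sub>l D = sl * sl"
    using pos by (auto simp: defs)
  have Qc: "Q (c_ratio D * x) = p * (ss / sl * x) * f"
    by (simp add: Q_F\<^sub>1 c_ratio_def real_sqrt_divide defs)
  have Q1: "Q\<^sub>1 x = p * x * e * E"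
    by (simp add: Q\<^sub>1_def defs)
  have P: "solid_conductance D x = k\<^sub>s D / (e * p * ss * E)"
    by (simp add: solid_conductance_def real_sqrt_mult exp_minus defs divide_inverse)
  have R: "liquid_conductance D x = k\<^sub>l D / (p * sl * f)"
    by (simp add: liquid_conductance_def real_sqrt_mult defs)
  have L: "latent_flux D x = \<gamma> D * \<rho> D * ss * x"
    by (simp add: latent_flux_def defs)
  define n where "n = k\<^sub>s D * sl * f + k\<^sub>l D * ss * e * E"
  have n: "0 < n"
    using pos dpos by (auto simp: n_def intro!: add_pos_pos mult_pos_pos)
  define m where "m = T\<^sub>1 * k\<^sub>s D * sl * f + T\<^sub>0 D * k\<^sub>l D * ss * e * E + \<gamma> D * \<rho> D * ss * x * e * p * ss * E * sl * f"
  have "G D T\<^sub>1 x = (p * ss * x * m) / (p * ss * x * n)"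
    unfolding G_def Qc Q1 as al m_def n_def
    by (rule arg_cong2[where f = "(/)"]) (use dpos in \<open>simp_all add: field_simps\<close>)
  also have "\<dots> = m / n"
    using dpos assms(2) by simp
  also have "\<dots> = (m / (e * p * ss * E * sl * f)) / (n / (e * p * ss * E * sl * f))"
    using dpos by simp
  also have "n / (e * p * ss * E * sl * f) = solid_conductance D x + liquid_conductance D x"
    unfolding P R n_def using dpos by (simp add: field_simps)
  also have "m / (e * p * ss * E * sl * f) =
      solid_conductance D x * T\<^sub>1 + liquid_conductance D x * T\<^sub>0 D + latent_flux D x"
    unfolding P R L m_def using dpos by (simp add: field_simps)
  finally show ?thesis .
qed

lemma G_iff_balance:
  assumes "alloy_data D" "0 < x"
  shows "T = G D T\<^sub>1 x \<longleftrightarrow>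
    solid_conductance D x * (T - T\<^sub>1) + liquid_conductance D x * (T - T\<^sub>0 D) = latent_flux D x"
  unfolding G_mean[OF assms] using conductance_pos[OF assms] by (intro weighted_mean_iff_balance)

text \<open>Dividing by the liquid conductance \<open>r\<close> gives
  \<open>G = T\<^sub>1 + (T\<^sub>0 - T\<^sub>1 + l / r) / (1 + p / r)\<close>. Here \<open>l / r\<close> is a multiple of \<open>Q (c * x)\<close>, hence
  increasing, while \<open>p / r\<close> decreases: \<open>p\<close> decreases because \<open>erf\<close> increases, and \<open>r\<close> increases
  because \<open>F\<^sub>1\<close> decreases. The numerator is positive because \<open>T\<^sub>1 < T\<^sub>0\<close>.\<close>

lemma G_strict_mono:
  assumes "alloy_data D" "T\<^sub>1 < T\<^sub>0 D" "0 < x" "x < y"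
  shows "G D T\<^sub>1 x < G D T\<^sub>1 y"
proof -
  note pos = alloy_data_pos[OF assms(1)]
  let ?p = "solid_conductance D" and ?r = "liquid_conductance D"
  let ?q = "\<lambda>z. \<gamma> D * \<rho> D * \<alpha>\<^sub>l D / k\<^sub>l D * Q (c_ratio D * z)"
  have G_eq: "G D T\<^sub>1 z = T\<^sub>1 + (T\<^sub>0 D - T\<^sub>1 + ?q z) / (1 + ?p z / ?r z)" if "0 < z" for z
  proof -
    have pr: "0 < ?p z" "0 < ?r z"
      using conductance_pos[OF assms(1) that] by auto
    have "?q z = latent_flux D z / ?r z"
      using pos F\<^sub>1_pos[of "c_ratio D * z"]
      by (simp add: Q_F\<^sub>1 liquid_conductance_def latent_flux_def real_sqrt_mult)
         (simp add: c_ratio_def real_sqrt_divide field_simps)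
    moreover have "1 + ?p z / ?r z = (?p z + ?r z) / ?r z"
      using pr by (simp add: field_simps)
    moreover have "?p z + ?r z \<noteq> 0"
      using pr by simp
    ultimately show ?thesis
      using pr unfolding G_mean[OF assms(1) that] by (simp add: field_simps)
  qed
  have y: "0 < y"
    using assms by simp
  have "?q x < ?q y"
    using pos assms(3,4) strict_monoD[OF Q_strict_mono] by (intro mult_strict_left_mono) auto
  moreover have "0 < ?q x"
    using pos assms(3) Q_pos[of "c_ratio D * x"] by simp
  moreover have "?p y / ?r y \<le> ?p x / ?r x"
  proof (rule frac_le)
    have "x\<^sup>2 < y\<^sup>2"
      using assms(3,4) by (simp add: power_strict_mono)
    moreover have "erf x < erf y"
      using assms(4) strict_monoD[OF erf_strict_mono] by simp
    ultimately show "?p y \<le> ?p x"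
      using pos erf_pos[OF assms(3)] unfolding solid_conductance_def
      by (intro frac_le mult_left_mono) auto
    have "F\<^sub>1 (c_ratio D * y) < F\<^sub>1 (c_ratio D * x)"
      using pos assms(3,4) by (intro F\<^sub>1_strict_antimono) auto
    then show "?r x \<le> ?r y"
      using pos F\<^sub>1_pos unfolding liquid_conductance_def
      by (intro frac_le mult_left_mono mult_pos_pos) auto
  qed (use conductance_pos[OF assms(1,3)] in auto)
  moreover have "0 < ?p y / ?r y"
    using conductance_pos[OF assms(1) y] by simp
  ultimately show ?thesis
    unfolding G_eq[OF assms(3)] G_eq[OF y] using assms(2)
    by (intro add_strict_left_mono frac_less) auto
qed

section \<open>Solute balance at the front\<close>

lemma M_greater_1:
  assumes "alloy_data D" "0 < x"
  shows "1 < M D x"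
  using alloy_data_pos[OF assms(1)] assms(2) Q_pos Q_less_1
  by (simp add: M_def one_less_inverse_iff)

lemma M_strict_antimono:
  assumes "alloy_data D" "0 < x" "x < y"
  shows "M D y < M D x"
  using alloy_data_pos[OF assms(1)] assms(2,3) Q_pos strict_monoD[OF Q_strict_mono]
  unfolding M_def by (intro less_imp_inverse_less) auto

lemma \<phi>_greater_1_imp_bracket:
  assumes "f\<^sub>l D T < f\<^sub>s D T" "1 < \<phi> D T"
  shows "f\<^sub>l D T < C\<^sub>0 D" "C\<^sub>0 D < f\<^sub>s D T"
proof -
  show *: "f\<^sub>l D T < C\<^sub>0 D"
  proof (rule ccontr)
    assume "\<not> f\<^sub>l D T < C\<^sub>0 D"
    \<comment> \<open>This includes \<open>f\<^sub>l T = C\<^sub>0\<close>, where \<open>\<phi>\<close> has the default value 0.\<close>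
    then have "\<phi> D T \<le> 0"
      unfolding \<phi>_def using assms(1) by (intro divide_nonneg_nonpos) auto
    then show False using assms(2) by simp
  qed
  then show "C\<^sub>0 D < f\<^sub>s D T"
    using assms(2) by (simp add: \<phi>_def)
qed

text \<open>On the bracket, \<open>\<phi> = 1 + (f\<^sub>s - C\<^sub>0) / (C\<^sub>0 - f\<^sub>l)\<close> has a positive increasing numerator and
  a positive decreasing denominator.\<close>

lemma \<phi>_strict_mono:
  assumes "strict_mono_on {a..b} (f\<^sub>l D)" "strict_mono_on {a..b} (f\<^sub>s D)"
    and "S \<in> {a..b}" "T \<in> {a..b}" "S < T" "C\<^sub>0 D < f\<^sub>s D S" "f\<^sub>l D T < C\<^sub>0 D"
  shows "\<phi> D S < \<phi> D T"
proof -
  have less: "f\<^sub>l D S < f\<^sub>l D T" "f\<^sub>s D S < f\<^sub>s D T"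
    using assms(3-5) strict_mono_onD[OF assms(1)] strict_mono_onD[OF assms(2)] by auto
  have "\<phi> D U = 1 + (f\<^sub>s D U - C\<^sub>0 D) / (C\<^sub>0 D - f\<^sub>l D U)" if "f\<^sub>l D U < C\<^sub>0 D" for U
    using that by (simp add: \<phi>_def field_simps)
  moreover have "(f\<^sub>s D S - C\<^sub>0 D) / (C\<^sub>0 D - f\<^sub>l D S) < (f\<^sub>s D T - C\<^sub>0 D) / (C\<^sub>0 D - f\<^sub>l D T)"
    using less assms(6,7) by (intro frac_less) auto
  ultimately show ?thesis
    using less assms(7) by simp
qed

lemma T\<^sub>0\<^sub>s_on_solidus:
  assumes "alloy_data D"
  shows "T\<^sub>0\<^sub>s D \<in> {T\<^sub>A D..T\<^sub>B D}" "f\<^sub>s D (T\<^sub>0\<^sub>s D) = C\<^sub>0 D"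
proof -
  from assms have "\<exists>T\<ge>T\<^sub>A D. T \<le> T\<^sub>B D \<and> f\<^sub>s D T = C\<^sub>0 D"
    by (intro IVT') (auto simp: alloy_data_def)
  then have img: "C\<^sub>0 D \<in> f\<^sub>s D ` {T\<^sub>A D..T\<^sub>B D}"
    unfolding image_iff by (metis atLeastAtMost_iff)
  have inj: "inj_on (f\<^sub>s D) {T\<^sub>A D..T\<^sub>B D}"
    using assms strict_mono_on_imp_inj_on by (auto simp: alloy_data_def)
  show "T\<^sub>0\<^sub>s D \<in> {T\<^sub>A D..T\<^sub>B D}" "f\<^sub>s D (T\<^sub>0\<^sub>s D) = C\<^sub>0 D"
    unfolding T\<^sub>0\<^sub>s_def using the_inv_into_into[OF inj img subset_refl] f_the_inv_into_f[OF inj img]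
    by auto
qed

lemma strict_mono_on_reflects_less:
  fixes f :: "real \<Rightarrow> real"
  assumes "strict_mono_on A f" "S \<in> A" "T \<in> A" "f S < f T"
  shows "S < T"
  using strict_mono_on_less[OF assms(1-3)] assms(4) by simp

text \<open>The bound on \<open>h\<^sub>0\<close> must be positive, and its numerator is: the alloy is initially liquid, so
  \<open>T\<^sub>0\<close> lies above the solidus temperature \<open>T\<^sub>0\<^sub>s\<close> of the composition \<open>C\<^sub>0\<close>.\<close>

lemma bulk_less_T\<^sub>0\<^sub>s:
  assumes "alloy_data D" "0 < h\<^sub>0"
    and "h\<^sub>0 < (T\<^sub>0 D - T\<^sub>0\<^sub>s D) * k\<^sub>l D / ((T\<^sub>0\<^sub>s D - T_bulk D) * sqrt (pi * \<alpha>\<^sub>l D))"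
  shows "T_bulk D < T\<^sub>0\<^sub>s D"
proof -
  have mono: "strict_mono_on {T\<^sub>A D..T\<^sub>B D} (f\<^sub>s D)" and T0: "T\<^sub>0 D \<in> {T\<^sub>A D..T\<^sub>B D}"
    and "C\<^sub>0 D < f\<^sub>s D (T\<^sub>0 D)"
    using assms(1) by (auto simp: alloy_data_def intro: less_trans)
  then have "T\<^sub>0\<^sub>s D < T\<^sub>0 D"
    using strict_mono_on_reflects_less[OF mono _ T0] T\<^sub>0\<^sub>s_on_solidus[OF assms(1)] by simp
  moreover have "0 < (T\<^sub>0 D - T\<^sub>0\<^sub>s D) * k\<^sub>l D / ((T\<^sub>0\<^sub>s D - T_bulk D) * sqrt (pi * \<alpha>\<^sub>l D))"
    using assms(2,3) by linarith
  ultimately show ?thesis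
    using alloy_data_pos[OF assms(1)] by (auto simp: zero_less_divide_iff zero_less_mult_iff mult_less_0_iff)
qed

lemma pair_bracket:
  assumes "alloy_data D" "0 < x" "T\<^sub>A D < T" "T < T\<^sub>B D" "M D x = \<phi> D T"
  shows "f\<^sub>l D T < C\<^sub>0 D" "C\<^sub>0 D < f\<^sub>s D T" "T\<^sub>0\<^sub>s D < T" "T < T\<^sub>0 D"
proof -
  have mono: "strict_mono_on {T\<^sub>A D..T\<^sub>B D} (f\<^sub>s D)" "strict_mono_on {T\<^sub>A D..T\<^sub>B D} (f\<^sub>l D)"
    and *: "f\<^sub>l D T < f\<^sub>s D T" "T \<in> {T\<^sub>A D..T\<^sub>B D}" "T\<^sub>0 D \<in> {T\<^sub>A D..T\<^sub>B D}" "C\<^sub>0 D < f\<^sub>l D (T\<^sub>0 D)"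
    using assms(1,3,4) by (auto simp: alloy_data_def)
  show f: "f\<^sub>l D T < C\<^sub>0 D" "C\<^sub>0 D < f\<^sub>s D T"
    using \<phi>_greater_1_imp_bracket[OF *(1)] M_greater_1[OF assms(1,2)] assms(5) by auto
  show "T\<^sub>0\<^sub>s D < T"
    using strict_mono_on_reflects_less[OF mono(1)] T\<^sub>0\<^sub>s_on_solidus[OF assms(1)] * f by simp
  show "T < T\<^sub>0 D"
    using strict_mono_on_reflects_less[OF mono(2)] * f by simp
qed

section \<open>Uniqueness of the Rubinstein pair\<close>

text \<open>For \<open>x < y\<close> the left side of \<open>M x = \<phi> (G x)\<close> would decrease and the right side increase.\<close>

lemma rubinstein_pair_unique:
  assumes "alloy_data D" "T\<^sub>1 < T\<^sub>0 D"
    and "rubinstein_pair D T\<^sub>1 x S" "rubinstein_pair D T\<^sub>1 y T"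
  shows "x = y" "S = T"
proof -
  have not_less: "\<not> x < y" if "rubinstein_pair D T\<^sub>1 x S" "rubinstein_pair D T\<^sub>1 y T" for x y S T
  proof
    assume "x < y"
    from that have x: "0 < x" "T\<^sub>A D < S" "S < T\<^sub>B D" "S = G D T\<^sub>1 x" "M D x = \<phi> D S"
      and y: "0 < y" "T\<^sub>A D < T" "T < T\<^sub>B D" "T = G D T\<^sub>1 y" "M D y = \<phi> D T"
      by (auto simp: rubinstein_pair_def)
    have "S < T"
      using G_strict_mono[OF assms(1,2) x(1) \<open>x < y\<close>] x y by simp
    then have "\<phi> D S < \<phi> D T"
      using \<phi>_strict_mono[of "T\<^sub>A D" "T\<^sub>B D" D S T] assms(1) x y
        pair_bracket(2)[OF assms(1) x(1,2,3,5)] pair_bracket(1)[OF assms(1) y(1,2,3,5)]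
      by (simp add: alloy_data_def)
    then show False
      using M_strict_antimono[OF assms(1) x(1) \<open>x < y\<close>] x y by simp
  qed
  show "x = y"
    using not_less[OF assms(3,4)] not_less[OF assms(4,3)] by simp
  then show "S = T"
    using assms(3,4) by (simp add: rubinstein_pair_def)
qed

section \<open>Verification of the free boundary conditions\<close>

lemma front_similarity_variable:
  assumes "0 < a" "0 < t"
  shows "front D \<delta> t / (2 * sqrt (a * t)) = sqrt (\<alpha>\<^sub>s D / a) * \<delta>"
  using assms by (simp add: front_def real_sqrt_mult real_sqrt_divide)

lemma front_deriv:
  assumes "0 < \<alpha>\<^sub>s D" "0 < t"
  shows "(front D \<delta> has_real_derivative \<delta> * sqrt (\<alpha>\<^sub>s D) / sqrt t) (at t)"
  unfolding front_def[abs_def] real_sqrt_mult using assms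
  by (auto intro!: derivative_eq_intros simp: field_simps)

lemma self_similar_front:
  assumes "0 < a" "0 < t"
  shows "self_similar a A B (front D \<delta> t) t = A + B * erf (sqrt (\<alpha>\<^sub>s D / a) * \<delta>)"
  by (simp add: self_similar_def front_similarity_variable[OF assms])

lemma self_similar_deriv_front:
  assumes "0 < a" "0 < t"
  shows "((\<lambda>x. self_similar a A B x t) has_real_derivative
           B * exp (- (sqrt (\<alpha>\<^sub>s D / a) * \<delta>)\<^sup>2) / sqrt (pi * a) / sqrt t) (at (front D \<delta> t) within S)"
  using self_similar_deriv_x[OF assms, of A B "front D \<delta> t" S]
  unfolding front_similarity_variable[OF assms] by (simp add: real_sqrt_mult mult_ac)

lemma erfc_profile_self_similar:
  "U + b * erfc (x / (2 * sqrt (a * t))) = self_similar a (U + b) (- b) x t"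
  by (simp add: self_similar_def erfc_def algebra_simps)

text \<open>The hypothesis \<open>energy\<close> is the heat balance at the front times \<open>sqrt t\<close>, with the slope \<open>B\<close> of the
  solid profile left free, so that it fits any condition at the face \<open>x = 0\<close>. The hypothesis
  \<open>mass\<close> is the solute balance, because the flux into the liquid is governed by
  \<open>F\<^sub>1\<close> at \<open>sqrt (\<alpha>\<^sub>s / d\<^sub>l) * \<delta>\<close> and the concentration in the solid is constant.\<close>

lemma free_boundary_conditions_self_similar:
  assumes data: "alloy_data D" and \<delta>: "0 < \<delta>" and T\<^sub>k: "T\<^sub>A D < T\<^sub>k" "T\<^sub>k < T\<^sub>B D"
    and mass: "M D \<delta> = \<phi> D T\<^sub>k"
    and interface: "A + B * erf \<delta> = T\<^sub>k"
    and energy: "k\<^sub>s D * (B * exp (- \<delta>\<^sup>2) / sqrt (pi * \<alpha>\<^sub>s D)) + liquid_conductance D \<delta> * (T\<^sub>k - T\<^sub>0 D)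
      = latent_flux D \<delta>"
  shows "free_boundary_conditions D (front D \<delta>) T\<^sub>k (self_similar (\<alpha>\<^sub>s D) A B)
    (liquid_T D \<delta> T\<^sub>k) (solid_C D T\<^sub>k) (liquid_C D \<delta> T\<^sub>k)"
proof -
  note pos = alloy_data_pos[OF data]
  let ?c = "c_ratio D" and ?m = "sqrt (\<alpha>\<^sub>s D / d\<^sub>l D)"
  define b where "b = (T\<^sub>k - T\<^sub>0 D) / erfc (?c * \<delta>)"
  define e where "e = (f\<^sub>l D T\<^sub>k - C\<^sub>0 D) / erfc (?m * \<delta>)"
  have lT: "liquid_T D \<delta> T\<^sub>k = self_similar (\<alpha>\<^sub>l D) (T\<^sub>0 D + b) (- b)"
    by (intro ext) (simp only: liquid_T_def erfc_profile_self_similar b_def)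
  have lC: "liquid_C D \<delta> T\<^sub>k = self_similar (d\<^sub>l D) (C\<^sub>0 D + e) (- e)"
    by (intro ext) (simp only: liquid_C_def erfc_profile_self_similar e_def)
  have sC: "solid_C D T\<^sub>k = (\<lambda>x t. f\<^sub>s D T\<^sub>k)"
    by (intro ext) (simp add: solid_C_def)
  have bc: "b * erfc (?c * \<delta>) = T\<^sub>k - T\<^sub>0 D" and ec: "e * erfc (?m * \<delta>) = f\<^sub>l D T\<^sub>k - C\<^sub>0 D"
    using erfc_pos[of "?c * \<delta>"] erfc_pos[of "?m * \<delta>"] by (auto simp: b_def e_def)
  have front_pos: "0 < front D \<delta> t" if "0 < t" for t
    using pos \<delta> that by (simp add: front_def)
  have heat_const: "heat_equation (d\<^sub>s D) (\<lambda>x t. f\<^sub>s D T\<^sub>k) \<Omega>" for \<Omega>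
    unfolding heat_equation_def
    by (rule exI[of _ "\<lambda>x t. 0"], rule exI[of _ "\<lambda>x t. 0"], rule exI[of _ "\<lambda>x t. 0"]) auto
  have stefan: "\<exists>s' T\<^sub>s\<^sub>x T\<^sub>l\<^sub>x C\<^sub>s\<^sub>x C\<^sub>l\<^sub>x.
        (front D \<delta> has_real_derivative s') (at t) \<and>
        ((\<lambda>x. self_similar (\<alpha>\<^sub>s D) A B x t) has_real_derivative T\<^sub>s\<^sub>x) (at (front D \<delta> t) within {0..front D \<delta> t}) \<and>
        ((\<lambda>x. self_similar (\<alpha>\<^sub>l D) (T\<^sub>0 D + b) (- b) x t) has_real_derivative T\<^sub>l\<^sub>x) (at (front D \<delta> t) within {front D \<delta> t..}) \<and>
        ((\<lambda>x. f\<^sub>s D T\<^sub>k) has_real_derivative C\<^sub>s\<^sub>x) (at (front D \<delta> t) within {0..front D \<delta> t}) \<and>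
        ((\<lambda>x. self_similar (d\<^sub>l D) (C\<^sub>0 D + e) (- e) x t) has_real_derivative C\<^sub>l\<^sub>x) (at (front D \<delta> t) within {front D \<delta> t..}) \<and>
        k\<^sub>s D * T\<^sub>s\<^sub>x - k\<^sub>l D * T\<^sub>l\<^sub>x = \<gamma> D * \<rho> D * s' \<and>
        d\<^sub>l D * C\<^sub>l\<^sub>x - d\<^sub>s D * C\<^sub>s\<^sub>x = (f\<^sub>s D T\<^sub>k - f\<^sub>l D T\<^sub>k) * s'" if t: "0 < t" for t
  proof (intro exI conjI)
    show "(front D \<delta> has_real_derivative \<delta> * sqrt (\<alpha>\<^sub>s D) / sqrt t) (at t)"
      by (rule front_deriv[OF pos(1) t])
    show "((\<lambda>x. self_similar (\<alpha>\<^sub>s D) A B x t) has_real_derivative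
        B * exp (- (sqrt (\<alpha>\<^sub>s D / \<alpha>\<^sub>s D) * \<delta>)\<^sup>2) / sqrt (pi * \<alpha>\<^sub>s D) / sqrt t) (at (front D \<delta> t) within {0..front D \<delta> t})"
      by (rule self_similar_deriv_front[OF pos(1) t])
    show "((\<lambda>x. self_similar (\<alpha>\<^sub>l D) (T\<^sub>0 D + b) (- b) x t) has_real_derivative
        - b * exp (- (sqrt (\<alpha>\<^sub>s D / \<alpha>\<^sub>l D) * \<delta>)\<^sup>2) / sqrt (pi * \<alpha>\<^sub>l D) / sqrt t) (at (front D \<delta> t) within {front D \<delta> t..})"
      by (rule self_similar_deriv_front[OF pos(2) t])
    show "((\<lambda>x. f\<^sub>s D T\<^sub>k) has_real_derivative 0) (at (front D \<delta> t) within {0..front D \<delta> t})"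
      by (rule DERIV_const)
    show "((\<lambda>x. self_similar (d\<^sub>l D) (C\<^sub>0 D + e) (- e) x t) has_real_derivative
        - e * exp (- (?m * \<delta>)\<^sup>2) / sqrt (pi * d\<^sub>l D) / sqrt t) (at (front D \<delta> t) within {front D \<delta> t..})"
      by (rule self_similar_deriv_front[OF pos(4) t])
    have "k\<^sub>l D * (b * exp (- (?c * \<delta>)\<^sup>2) / sqrt (pi * \<alpha>\<^sub>l D)) = liquid_conductance D \<delta> * (T\<^sub>k - T\<^sub>0 D)"
      by (simp add: liquid_conductance_def b_def F\<^sub>1_def exp_minus divide_inverse mult_ac)
    with energy have "k\<^sub>s D * (B * exp (- \<delta>\<^sup>2) / sqrt (pi * \<alpha>\<^sub>s D))
        + k\<^sub>l D * (b * exp (- (?c * \<delta>)\<^sup>2) / sqrt (pi * \<alpha>\<^sub>l D)) = \<gamma> D * \<rho> D * (\<delta> * sqrt (\<alpha>\<^sub>s D))"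
      by (simp add: latent_flux_def mult_ac)
    then have "(k\<^sub>s D * (B * exp (- \<delta>\<^sup>2) / sqrt (pi * \<alpha>\<^sub>s D))
        + k\<^sub>l D * (b * exp (- (?c * \<delta>)\<^sup>2) / sqrt (pi * \<alpha>\<^sub>l D))) / sqrt t
        = \<gamma> D * \<rho> D * (\<delta> * sqrt (\<alpha>\<^sub>s D)) / sqrt t"
      by simp
    then show "k\<^sub>s D * (B * exp (- (sqrt (\<alpha>\<^sub>s D / \<alpha>\<^sub>s D) * \<delta>)\<^sup>2) / sqrt (pi * \<alpha>\<^sub>s D) / sqrt t)
        - k\<^sub>l D * (- b * exp (- (sqrt (\<alpha>\<^sub>s D / \<alpha>\<^sub>l D) * \<delta>)\<^sup>2) / sqrt (pi * \<alpha>\<^sub>l D) / sqrt t)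
        = \<gamma> D * \<rho> D * (\<delta> * sqrt (\<alpha>\<^sub>s D) / sqrt t)"
      using pos(1) by (simp add: c_ratio_def add_divide_distrib)
    have C: "f\<^sub>l D T\<^sub>k < C\<^sub>0 D"
      by (rule pair_bracket(1)[OF data \<delta> T\<^sub>k mass])
    have F: "0 < F\<^sub>1 (?m * \<delta>)"
      by (rule F\<^sub>1_pos)
    have "(f\<^sub>s D T\<^sub>k - f\<^sub>l D T\<^sub>k) / (C\<^sub>0 D - f\<^sub>l D T\<^sub>k) = 1 / (sqrt pi * (?m * \<delta>) * F\<^sub>1 (?m * \<delta>))"
      using mass by (simp add: M_def \<phi>_def Q_F\<^sub>1 inverse_eq_divide)
    then have m: "(f\<^sub>s D T\<^sub>k - f\<^sub>l D T\<^sub>k) * (?m * \<delta>) = (C\<^sub>0 D - f\<^sub>l D T\<^sub>k) / (sqrt pi * F\<^sub>1 (?m * \<delta>))"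
      using C F \<delta> pos(1,4) by (simp add: field_simps)
    have md: "sqrt (\<alpha>\<^sub>s D) = ?m * sqrt (d\<^sub>l D)"
      using pos(4) by (simp add: real_sqrt_divide)
    have "- e * exp (- (?m * \<delta>)\<^sup>2) = (C\<^sub>0 D - f\<^sub>l D T\<^sub>k) / F\<^sub>1 (?m * \<delta>)"
      by (simp add: e_def F\<^sub>1_def exp_minus divide_inverse algebra_simps)
    then have "d\<^sub>l D * (- e * exp (- (?m * \<delta>)\<^sup>2) / sqrt (pi * d\<^sub>l D))
        = (C\<^sub>0 D - f\<^sub>l D T\<^sub>k) / (sqrt pi * F\<^sub>1 (?m * \<delta>)) * (d\<^sub>l D / sqrt (d\<^sub>l D))"
      by (simp add: real_sqrt_mult mult_ac)
    also have "\<dots> = (f\<^sub>s D T\<^sub>k - f\<^sub>l D T\<^sub>k) * (\<delta> * sqrt (\<alpha>\<^sub>s D))"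
      unfolding m[symmetric] md using pos(4) by (simp add: real_div_sqrt mult_ac)
    finally have "d\<^sub>l D * (- e * exp (- (?m * \<delta>)\<^sup>2) / sqrt (pi * d\<^sub>l D)) / sqrt t
        = (f\<^sub>s D T\<^sub>k - f\<^sub>l D T\<^sub>k) * (\<delta> * sqrt (\<alpha>\<^sub>s D)) / sqrt t"
      by (rule arg_cong)
    then show "d\<^sub>l D * (- e * exp (- (?m * \<delta>)\<^sup>2) / sqrt (pi * d\<^sub>l D) / sqrt t) - d\<^sub>s D * 0
        = (f\<^sub>s D T\<^sub>k - f\<^sub>l D T\<^sub>k) * (\<delta> * sqrt (\<alpha>\<^sub>s D) / sqrt t)"
      by (simp only: times_divide_eq_right mult_zero_right diff_zero)
  qed
  have val: "self_similar (\<alpha>\<^sub>s D) A B (front D \<delta> t) t = T\<^sub>k"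
    "self_similar (\<alpha>\<^sub>l D) (T\<^sub>0 D + b) (- b) (front D \<delta> t) t = T\<^sub>k"
    "self_similar (d\<^sub>l D) (C\<^sub>0 D + e) (- e) (front D \<delta> t) t = f\<^sub>l D T\<^sub>k" if "0 < t" for t
  proof -
    show "self_similar (\<alpha>\<^sub>s D) A B (front D \<delta> t) t = T\<^sub>k"
      using interface pos(1) that by (simp add: self_similar_front)
    show "self_similar (\<alpha>\<^sub>l D) (T\<^sub>0 D + b) (- b) (front D \<delta> t) t = T\<^sub>k"
      using bc pos(2) that by (simp add: self_similar_front erfc_def algebra_simps flip: c_ratio_def)
    show "self_similar (d\<^sub>l D) (C\<^sub>0 D + e) (- e) (front D \<delta> t) t = f\<^sub>l D T\<^sub>k"
      using ec pos(4) that by (simp add: self_similar_front erfc_def algebra_simps)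
  qed
  have lims: "((\<lambda>t. self_similar (\<alpha>\<^sub>l D) (T\<^sub>0 D + b) (- b) x t) \<longlongrightarrow> T\<^sub>0 D) (at_right 0)"
    "((\<lambda>t. self_similar (d\<^sub>l D) (C\<^sub>0 D + e) (- e) x t) \<longlongrightarrow> C\<^sub>0 D) (at_right 0)" if "0 < x" for x
    using self_similar_initially[OF pos(2) that, of "T\<^sub>0 D + b" "- b"]
      self_similar_initially[OF pos(4) that, of "C\<^sub>0 D + e" "- e"] by simp_all
  have inf: "((\<lambda>x. self_similar (\<alpha>\<^sub>l D) (T\<^sub>0 D + b) (- b) x t) \<longlongrightarrow> T\<^sub>0 D) at_top" if "0 < t" for t
    using self_similar_at_infinity[OF pos(2) that, of "T\<^sub>0 D + b" "- b"] by simp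
  show ?thesis
    unfolding free_boundary_conditions_def lT lC sC
    by (intro conjI allI impI; (rule stefan front_pos T\<^sub>k val lims inf heat_const refl DERIV_const
          self_similar_heat_equation self_similar_continuous continuous_on_const pos)?; (clarsimp; fail)?)
       (use pos in \<open>auto intro: less_trans[OF front_pos]\<close>)
qed

section \<open>Comparison of the two problems\<close>

lemma similarity_T\<^sub>s_self_similar:
  "similarity_T\<^sub>s D h\<^sub>0 \<delta> T\<^sub>k = self_similar (\<alpha>\<^sub>s D) (face_temperature D h\<^sub>0 \<delta> T\<^sub>k)
     (h\<^sub>0 * sqrt (pi * \<alpha>\<^sub>s D) * (T\<^sub>k - T_bulk D) / (k\<^sub>s D + h\<^sub>0 * sqrt (pi * \<alpha>\<^sub>s D) * erf \<delta>))"
  by (intro ext)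
    (simp add: similarity_T\<^sub>s_def self_similar_def face_temperature_def right_diff_distrib,
     simp add: algebra_simps)

lemma rubinstein_T\<^sub>s_self_similar:
  "rubinstein_T\<^sub>s D T\<^sub>1 \<mu> T\<^sub>k = self_similar (\<alpha>\<^sub>s D) T\<^sub>1 ((T\<^sub>k - T\<^sub>1) / erf \<mu>)"
  by (intro ext) (simp add: rubinstein_T\<^sub>s_def self_similar_def)

text \<open>The left side is the slope of the Rubinstein profile and the right side that of the convective one,
  so the two solid temperatures coincide.\<close>

lemma face_temperature_slope:
  assumes "0 < \<delta>"
  shows "(T\<^sub>k - face_temperature D h\<^sub>0 \<delta> T\<^sub>k) / erf \<delta> =
     h\<^sub>0 * sqrt (pi * \<alpha>\<^sub>s D) * (T\<^sub>k - T_bulk D) / (k\<^sub>s D + h\<^sub>0 * sqrt (pi * \<alpha>\<^sub>s D) * erf \<delta>)"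
  using erf_pos[OF assms] by (simp add: face_temperature_def)

lemma face_temperature_equal_flux:
  assumes "alloy_data D" "0 < \<delta>"
  shows "solid_conductance D \<delta> * (T\<^sub>k - face_temperature D h\<^sub>0 \<delta> T\<^sub>k)
    = convective_conductance D h\<^sub>0 \<delta> * (T\<^sub>k - T_bulk D)"
proof -
  note pos = alloy_data_pos[OF assms(1)]
  have "solid_conductance D \<delta> * (T\<^sub>k - face_temperature D h\<^sub>0 \<delta> T\<^sub>k)
      = k\<^sub>s D * exp (- \<delta>\<^sup>2) / sqrt (pi * \<alpha>\<^sub>s D) * ((T\<^sub>k - face_temperature D h\<^sub>0 \<delta> T\<^sub>k) / erf \<delta>)"
    by (simp add: solid_conductance_def)
  also have "\<dots> = convective_conductance D h\<^sub>0 \<delta> * (T\<^sub>k - T_bulk D)"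
    unfolding face_temperature_slope[OF assms(2)] convective_conductance_def
    using pos(1) by (simp add: mult_ac)
  finally show ?thesis .
qed

text \<open>By the equality of fluxes, the balance that characterises \<open>W\<close> is the one that characterises \<open>G\<close>.\<close>

lemma rubinstein_pair_face_temperature:
  assumes "alloy_data D" "0 < h\<^sub>0" "similarity_pair D h\<^sub>0 \<delta> T\<^sub>k"
  shows "rubinstein_pair D (face_temperature D h\<^sub>0 \<delta> T\<^sub>k) \<delta> T\<^sub>k"
proof -
  have \<delta>: "0 < \<delta>" and "T\<^sub>k = W D h\<^sub>0 \<delta>"
    using assms(3) by (auto simp: similarity_pair_def)
  then have "T\<^sub>k = G D (face_temperature D h\<^sub>0 \<delta> T\<^sub>k) \<delta>"
    unfolding W_iff_balance[OF assms(1,2) \<delta>] G_iff_balance[OF assms(1) \<delta>]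
      face_temperature_equal_flux[OF assms(1) \<delta>] by simp
  then show ?thesis
    using assms(3) unfolding similarity_pair_def rubinstein_pair_def by blast
qed

lemma similarity_solves_P\<^sub>2:
  assumes data: "alloy_data D" and h\<^sub>0: "0 < h\<^sub>0" and pair: "similarity_pair D h\<^sub>0 \<delta> T\<^sub>k"
  shows "solves_P\<^sub>2 D h\<^sub>0 (front D \<delta>) T\<^sub>k
       (similarity_T\<^sub>s D h\<^sub>0 \<delta> T\<^sub>k) (liquid_T D \<delta> T\<^sub>k) (solid_C D T\<^sub>k) (liquid_C D \<delta> T\<^sub>k)"
proof -
  note pos = alloy_data_pos[OF data]
  define n where "n = k\<^sub>s D + h\<^sub>0 * sqrt (pi * \<alpha>\<^sub>s D) * erf \<delta>"
  define A where "A = face_temperature D h\<^sub>0 \<delta> T\<^sub>k"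
  define B where "B = h\<^sub>0 * sqrt (pi * \<alpha>\<^sub>s D) * (T\<^sub>k - T_bulk D) / n"
  from pair have \<delta>: "0 < \<delta>" and T\<^sub>k: "T\<^sub>A D < T\<^sub>k" "T\<^sub>k < T\<^sub>B D" and mass: "M D \<delta> = \<phi> D T\<^sub>k"
    and W: "T\<^sub>k = W D h\<^sub>0 \<delta>"
    by (auto simp: similarity_pair_def)
  have n: "0 < n"
    using pos h\<^sub>0 erf_pos[OF \<delta>] by (auto simp: n_def intro!: add_pos_pos)
  have A_B: "A + B * erf \<delta> = T\<^sub>k"
    by (simp add: A_def B_def n_def face_temperature_def)
  have Ts: "similarity_T\<^sub>s D h\<^sub>0 \<delta> T\<^sub>k = self_similar (\<alpha>\<^sub>s D) A B"
    by (simp add: similarity_T\<^sub>s_self_similar A_def B_def n_def)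
  have flux: "k\<^sub>s D * (B * exp (- \<delta>\<^sup>2) / sqrt (pi * \<alpha>\<^sub>s D)) = convective_conductance D h\<^sub>0 \<delta> * (T\<^sub>k - T_bulk D)"
    using pos(1) by (simp add: B_def convective_conductance_def n_def mult_ac)
  have free: "free_boundary_conditions D (front D \<delta>) T\<^sub>k (self_similar (\<alpha>\<^sub>s D) A B)
    (liquid_T D \<delta> T\<^sub>k) (solid_C D T\<^sub>k) (liquid_C D \<delta> T\<^sub>k)"
    using W unfolding W_iff_balance[OF data h\<^sub>0 \<delta>] flux[symmetric]
    by (rule free_boundary_conditions_self_similar[OF data \<delta> T\<^sub>k mass A_B])
  have "\<exists>T\<^sub>s\<^sub>x. ((\<lambda>x. self_similar (\<alpha>\<^sub>s D) A B x t) has_real_derivative T\<^sub>s\<^sub>x) (at 0 within {0..front D \<delta> t}) \<and>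
        k\<^sub>s D * T\<^sub>s\<^sub>x = h\<^sub>0 / sqrt t * (self_similar (\<alpha>\<^sub>s D) A B 0 t - T_bulk D)" if t: "0 < t" for t
  proof (intro exI conjI)
    show "((\<lambda>x. self_similar (\<alpha>\<^sub>s D) A B x t) has_real_derivative B / sqrt (pi * (\<alpha>\<^sub>s D * t))) (at 0 within {0..front D \<delta> t})"
      using self_similar_deriv_x[OF pos(1) t, of A B 0] by simp
    \<comment> \<open>The drop \<open>T\<^sub>k - T_bulk\<close> is divided between convection at the face and conduction in the solid
      in the ratio of their resistances, which is \<open>k\<^sub>s\<close> to \<open>n - k\<^sub>s\<close>.\<close>
    have "A - T_bulk D = (T\<^sub>k - T_bulk D) * k\<^sub>s D / n"
    proof -
      have "A - T_bulk D = (T\<^sub>k - T_bulk D) - (n - k\<^sub>s D) * (T\<^sub>k - T_bulk D) / n"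
        by (simp add: A_def face_temperature_def n_def mult_ac)
      also have "\<dots> = (T\<^sub>k - T_bulk D) * k\<^sub>s D / n"
        using n by (simp add: field_simps)
      finally show ?thesis .
    qed
    moreover have "k\<^sub>s D * (B / sqrt (pi * (\<alpha>\<^sub>s D * t))) = h\<^sub>0 / sqrt t * ((T\<^sub>k - T_bulk D) * k\<^sub>s D / n)"
      using pos(1) by (simp add: B_def real_sqrt_mult mult_ac)
    ultimately show "k\<^sub>s D * (B / sqrt (pi * (\<alpha>\<^sub>s D * t)))
        = h\<^sub>0 / sqrt t * (self_similar (\<alpha>\<^sub>s D) A B 0 t - T_bulk D)"
      by (simp add: self_similar_def)
  qed
  then show ?thesis
    using free by (simp add: solves_P\<^sub>2_def Ts)
qed

lemma face_temperature_less:
  assumes "alloy_data D" "0 < h\<^sub>0" "0 < \<delta>" "T_bulk D < T\<^sub>k"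
  shows "face_temperature D h\<^sub>0 \<delta> T\<^sub>k < T\<^sub>k"
  using alloy_data_pos[OF assms(1)] erf_pos[OF assms(3)] assms(2,4)
  by (auto simp: face_temperature_def intro!: divide_pos_pos mult_pos_pos add_pos_pos)

theorem theorem5p1:
  fixes D :: alloy and h\<^sub>0 \<delta> That\<^sub>k That\<^sub>1 :: real
  assumes data: "alloy_data D"
    and bounds_defined: "T_bulk D \<noteq> T\<^sub>0\<^sub>l D" "T_bulk D \<noteq> T\<^sub>0\<^sub>s D"
    and h\<^sub>0_pos: "0 < h\<^sub>0"
    and h\<^sub>0_lower: "(T\<^sub>0 D - T\<^sub>0\<^sub>l D) * k\<^sub>l D / ((T\<^sub>0\<^sub>l D - T_bulk D) * sqrt (pi * \<alpha>\<^sub>l D)) < h\<^sub>0"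
    and h\<^sub>0_upper: "h\<^sub>0 < (T\<^sub>0 D - T\<^sub>0\<^sub>s D) * k\<^sub>l D / ((T\<^sub>0\<^sub>s D - T_bulk D) * sqrt (pi * \<alpha>\<^sub>l D))"
    and similarity: "similarity_pair D h\<^sub>0 \<delta> That\<^sub>k"
    and That\<^sub>1: "That\<^sub>1 = face_temperature D h\<^sub>0 \<delta> That\<^sub>k"
  shows
    "solves_P\<^sub>2 D h\<^sub>0 (front D \<delta>) That\<^sub>k
       (similarity_T\<^sub>s D h\<^sub>0 \<delta> That\<^sub>k) (liquid_T D \<delta> That\<^sub>k) (solid_C D That\<^sub>k) (liquid_C D \<delta> That\<^sub>k) \<and>
     (\<forall>t>0. similarity_T\<^sub>s D h\<^sub>0 \<delta> That\<^sub>k 0 t = That\<^sub>1) \<and>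
     (\<exists>!(\<mu>, Ttilde\<^sub>k). rubinstein_pair D That\<^sub>1 \<mu> Ttilde\<^sub>k) \<and>
     (\<forall>\<mu> Ttilde\<^sub>k. rubinstein_pair D That\<^sub>1 \<mu> Ttilde\<^sub>k \<longrightarrow>
        solves_P\<^sub>R D That\<^sub>1 (front D \<mu>) Ttilde\<^sub>k
          (rubinstein_T\<^sub>s D That\<^sub>1 \<mu> Ttilde\<^sub>k) (liquid_T D \<mu> Ttilde\<^sub>k)
          (solid_C D Ttilde\<^sub>k) (liquid_C D \<mu> Ttilde\<^sub>k) \<and>
        \<mu> = \<delta> \<and> That\<^sub>k = Ttilde\<^sub>k \<and>
        (\<forall>x t. 0 < t \<and> 0 < x \<and> x < front D \<delta> t \<longrightarrow>
           similarity_T\<^sub>s D h\<^sub>0 \<delta> That\<^sub>k x t = rubinstein_T\<^sub>s D That\<^sub>1 \<mu> Ttilde\<^sub>k x t \<and>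
           solid_C D That\<^sub>k x t = solid_C D Ttilde\<^sub>k x t) \<and>
        (\<forall>x t. 0 < t \<and> front D \<delta> t < x \<longrightarrow>
           liquid_T D \<delta> That\<^sub>k x t = liquid_T D \<mu> Ttilde\<^sub>k x t \<and>
           liquid_C D \<delta> That\<^sub>k x t = liquid_C D \<mu> Ttilde\<^sub>k x t))"
proof -
  from similarity have \<delta>: "0 < \<delta>" and Tk: "T\<^sub>A D < That\<^sub>k" "That\<^sub>k < T\<^sub>B D" and mass: "M D \<delta> = \<phi> D That\<^sub>k"
    by (auto simp: similarity_pair_def)
  note bracket = pair_bracket[OF data \<delta> Tk mass]
  have P\<^sub>2: "solves_P\<^sub>2 D h\<^sub>0 (front D \<delta>) That\<^sub>k (similarity_T\<^sub>s D h\<^sub>0 \<delta> That\<^sub>k)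
      (liquid_T D \<delta> That\<^sub>k) (solid_C D That\<^sub>k) (liquid_C D \<delta> That\<^sub>k)"
    by (rule similarity_solves_P\<^sub>2[OF data h\<^sub>0_pos similarity])
  have face: "similarity_T\<^sub>s D h\<^sub>0 \<delta> That\<^sub>k 0 t = That\<^sub>1" for t
    by (simp add: similarity_T\<^sub>s_self_similar self_similar_def That\<^sub>1)
  have solid_eq: "rubinstein_T\<^sub>s D That\<^sub>1 \<delta> That\<^sub>k = similarity_T\<^sub>s D h\<^sub>0 \<delta> That\<^sub>k"
    unfolding That\<^sub>1 rubinstein_T\<^sub>s_self_similar similarity_T\<^sub>s_self_similar face_temperature_slope[OF \<delta>] ..
  have pair: "rubinstein_pair D That\<^sub>1 \<delta> That\<^sub>k"
    unfolding That\<^sub>1 by (rule rubinstein_pair_face_temperature[OF data h\<^sub>0_pos similarity])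
  have "That\<^sub>1 < T\<^sub>0 D"
    using face_temperature_less[OF data h\<^sub>0_pos \<delta>] bulk_less_T\<^sub>0\<^sub>s[OF data h\<^sub>0_pos h\<^sub>0_upper] bracket
    unfolding That\<^sub>1 by (meson less_trans)
  then have unique: "\<mu> = \<delta> \<and> T = That\<^sub>k" if "rubinstein_pair D That\<^sub>1 \<mu> T" for \<mu> T
    using rubinstein_pair_unique[OF data _ that pair] by simp
  have P\<^sub>R: "solves_P\<^sub>R D That\<^sub>1 (front D \<delta>) That\<^sub>k (rubinstein_T\<^sub>s D That\<^sub>1 \<delta> That\<^sub>k)
      (liquid_T D \<delta> That\<^sub>k) (solid_C D That\<^sub>k) (liquid_C D \<delta> That\<^sub>k)"
    using P\<^sub>2 face by (simp add: solves_P\<^sub>2_def solves_P\<^sub>R_def solid_eq)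
  have "\<exists>!(\<mu>, T). rubinstein_pair D That\<^sub>1 \<mu> T"
  proof (rule ex1I[of _ "(\<delta>, That\<^sub>k)"])
    show "case (\<delta>, That\<^sub>k) of (\<mu>, T) \<Rightarrow> rubinstein_pair D That\<^sub>1 \<mu> T"
      using pair by simp
    show "p = (\<delta>, That\<^sub>k)" if "case p of (\<mu>, T) \<Rightarrow> rubinstein_pair D That\<^sub>1 \<mu> T" for p
      using that unique[of "fst p" "snd p"] by (simp add: case_prod_beta prod_eq_iff)
  qed
  show ?thesis
  proof (intro conjI allI impI)
    fix \<mu> T assume "rubinstein_pair D That\<^sub>1 \<mu> T"
    from unique[OF this] have [simp]: "\<mu> = \<delta>" "T = That\<^sub>k"
      by simp_all
    show "solves_P\<^sub>R D That\<^sub>1 (front D \<mu>) T (rubinstein_T\<^sub>s D That\<^sub>1 \<mu> T)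
        (liquid_T D \<mu> T) (solid_C D T) (liquid_C D \<mu> T)"
      using P\<^sub>R by simp
    show "\<mu> = \<delta>" "That\<^sub>k = T"
      by simp_all
    fix x t
    show "similarity_T\<^sub>s D h\<^sub>0 \<delta> That\<^sub>k x t = rubinstein_T\<^sub>s D That\<^sub>1 \<mu> T x t"
      "solid_C D That\<^sub>k x t = solid_C D T x t"
      "liquid_T D \<delta> That\<^sub>k x t = liquid_T D \<mu> T x t"
      "liquid_C D \<delta> That\<^sub>k x t = liquid_C D \<mu> T x t"
      by (simp_all add: solid_eq)
  qed (rule P\<^sub>2 face \<open>\<exists>!(\<mu>, T). rubinstein_pair D That\<^sub>1 \<mu> T\<close>)+
qed

end
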